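(* Let $\mu$ be a probability measure on $\mathbb{R}$ with $Is(\mu)>0$, with a positive density $f$ on $\mathbb{R}$ and cumulative distribution function $F$. Let $p\in[1,+\infty)$ and let $u\in L_p(F)$ be absolutely continuous. Then: 1. $$\|u-\mathbb{E}[u]\|_p\le 2p\,[Is(\mu)]^{-1}\|u'\|_p .$$ 2. If in addition $\mathbb{E}\big[\operatorname{sign}(u-\mathbb{E}[u])\,|u-\mathbb{E}[u]|^{p-1}\big]=0$ (for instance if $p$ is an even integer and $\mathbb{E}[(u-\mathbb{E}[u])^{p-1}]=0$), then $$\|u-\mathbb{E}[u]\|_p\le p\,[Is(\mu)]^{-1}\|u'\|_p .$$ 3. If $p$ is an odd integer and $\mathbb{E}[u^p]=0$, then $$\|u\|_p\le 2p\,[Is(\mu)]^{-1}\|u'\|_p .$$ 4. If $p$ is an odd integer, $\mathbb{E}[u^p]=0$ and in addition $\mathbb{E}[\operatorname{sign}(u^p)]=0$, then $$\|u\|_p\le p\,[Is(\mu)]^{-1}\|u'\|_p .$$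
   Context: All norms and expectations are with respect to $\mu$. Absolutely continuous functions on $\mathbb{R}$ are understood to be absolutely continuous on every compact interval. The sign function is $\operatorname{sign}(x)=2\,\mathbf{1}_{\{x\ge0\}}-1$. $Is(\mu)$ is the Cheeger isoperimetric constant: the largest $c\ge 0$ such that $\mu^+(A)\ge c\min\{\mu(A),1-\mu(A)\}$ for all measurable $A\subset\mathbb{R}$, where $\mu^+(A)=\liminf_{h\to0^+}(\mu(A^h)-\mu(A))/h$ and $A^h=\{x:\exists a\in A,\ |x-a|<h\}$. On $\mathbb{R}$, $Is(\mu)=\operatorname{ess\,inf}_{a<x<b}\frac{f(x)}{\min\{F(x),1-F(x)\}}$ (with respect to Lebesgue measure), where $a=\inf\{x:F(x)>0\}$, $b=\sup\{x:F(x)<1\}$. *)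

theory Defs
  imports "HOL-Probability.Probability"
begin

definition rsign :: "real \<Rightarrow> real" where
  "rsign x = 2 * indicator {0..} x - 1"

text \<open>Powers of nonnegative reals with \<open>0\<^sup>0 = 1\<close>; the library has \<open>0 powr 0 = 0\<close>.\<close>

definition nonneg_power :: "real \<Rightarrow> real \<Rightarrow> real" where
  "nonneg_power x a = (if a = 0 then 1 else x powr a)"

definition enlargement :: "real \<Rightarrow> real set \<Rightarrow> real set" where
  "enlargement h A = {x. \<exists>a\<in>A. \<bar>x - a\<bar> < h}"

definition boundary_measure :: "real measure \<Rightarrow> real set \<Rightarrow> ennreal" where
  "boundary_measure M A =
     Liminf (at_right (0::real)) (\<lambda>h. ennreal ((measure M (enlargement h A) - measure M A) / h))"

text \<open>The set of admissible constants is closed, so this supremum is the largest admissible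
  constant whenever it is finite.\<close>

definition cheeger_const :: "real measure \<Rightarrow> ennreal" where
  "cheeger_const M =
     Sup {ennreal c | c. 0 \<le> c \<and>
       (\<forall>A\<in>sets borel. ennreal (c * min (measure M A) (1 - measure M A)) \<le> boundary_measure M A)}"

definition abs_continuous_on_Icc :: "real \<Rightarrow> real \<Rightarrow> (real \<Rightarrow> real) \<Rightarrow> bool" where
  "abs_continuous_on_Icc a b u \<longleftrightarrow>
     (\<forall>\<epsilon>>0. \<exists>\<delta>>0. \<forall>(n::nat) s t.
        (\<forall>i<n. a \<le> s i \<and> s i \<le> t i \<and> t i \<le> b) \<and>
        disjoint_family_on (\<lambda>i. {s i<..<t i}) {..<n} \<and>
        (\<Sum>i<n. t i - s i) < \<delta> \<longrightarrow>
        (\<Sum>i<n. \<bar>u (t i) - u (s i)\<bar>) < \<epsilon>)"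

definition locally_abs_continuous :: "(real \<Rightarrow> real) \<Rightarrow> bool" where
  "locally_abs_continuous u \<longleftrightarrow> (\<forall>a b. a \<le> b \<longrightarrow> abs_continuous_on_Icc a b u)"

definition Lp_norm :: "'a measure \<Rightarrow> real \<Rightarrow> ('a \<Rightarrow> real) \<Rightarrow> ennreal" where
  "Lp_norm M p g =
     (let I = (\<integral>\<^sup>+x. ennreal (\<bar>g x\<bar> powr p) \<partial>M)
      in if I = \<infinity> then \<infinity> else ennreal (enn2real I powr (1 / p)))"

definition Lp_functions :: "'a measure \<Rightarrow> real \<Rightarrow> ('a \<Rightarrow> real) set" where
  "Lp_functions M p = {g \<in> borel_measurable M. Lp_norm M p g < \<infinity>}"

text \<open>Below, \<open>u'\<close> is rendered by \<open>deriv u\<close>. A locally absolutely continuous \<open>u\<close> is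
  differentiable Lebesgue-almost everywhere; on the remaining null set \<open>deriv u\<close> has an
  unspecified real value, which does not affect norms with respect to measures having a density.
  These norms may be infinite.\<close>

end

theory Submission
  imports Defs
begin

text \<open>
  Let \<open>F\<close> be the distribution function, \<open>m = min F (1 - F)\<close> and \<open>c\<close> the Cheeger constant. Testing the
  isoperimetric inequality on half-lines gives \<open>c * m \<le> F'\<close> wherever \<open>F\<close> is differentiable. For a median
  \<open>x0\<close> and a locally absolutely continuous \<open>w\<close>, writing \<open>w x - w x0\<close> as the integral of \<open>w'\<close> and exchanging
  the order of integration yields \<open>E \<bar>w - w x0\<bar> \<le> \<integral> \<bar>w'\<bar> m \<le> E \<bar>w'\<bar> / c\<close>.
  Applied to \<open>w = sign z * \<bar>z\<bar> powr p\<close> with \<open>z = u - u x0\<close> and combined with Young's inequality this is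
  \<open>\<parallel>u - u x0\<parallel> \<le> (p / c) * \<parallel>u'\<parallel>\<close> in \<open>L\<^sub>p\<close>. Passing from \<open>u x0\<close> to the mean costs a factor 2, and costs nothing
  when the mean already minimises \<open>a \<mapsto> E \<bar>u - a\<bar> powr p\<close>, which is what the sign condition says. For odd \<open>p\<close>
  one argues in the same way with \<open>w = u ^ p\<close> at the level of \<open>L\<^sub>1\<close>.

  The differentiability almost everywhere of absolutely continuous functions is obtained directly from
  Vitali's covering theorem, without a detour through monotone functions.
\<close>

section \<open>Absolutely continuous functions\<close>

text \<open>The isoperimetric inequality controls difference quotients of \<open>F\<close>, not a
  chosen version of the density, so the argument is run with \<open>F'\<close>. The measure is
  recovered from \<open>F'\<close> because \<open>F\<close> is itself absolutely continuous; the
  calculus of absolutely continuous functions thus serves twice, for \<open>u\<close> and for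
  \<open>F\<close>. The base point is a median because then a point \<open>y\<close> other than
  \<open>x0\<close> lies between \<open>x0\<close> and a random \<open>x\<close> with probability
  exactly \<open>m y\<close>. On the side of moments, Young's inequality is the only source. Read as
  a tangent-line inequality for \<open>\<bar>t\<bar> powr p\<close> it yields the midpoint bound,
  Jensen's inequality and the minimality under the sign condition; integrated, it passes from first
  to \<open>p\<close>-th moments. The factor 2 in the first bound is the \<open>p\<close>-th root of
  \<open>2 powr p\<close>: half of that power comes from the midpoint bound, the remaining 2 from
  Jensen. For odd \<open>p\<close> the factor 2 arises for first moments of \<open>u ^ n\<close>; it
  then multiplies \<open>1 / c\<close> before the exponent is raised, and the result is again
  \<open>2 * p / c\<close>.\<close>

lemma division_of_real_cases:
  fixes D :: "real set set"
  assumes "D division_of S" "K \<in> D"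
  obtains c d where "c \<le> d" "K = {c..d}" "Inf K = c" "Sup K = d" "measure lborel K = d - c"
proof -
  from assms obtain c d where K: "K = cbox c d" by blast
  moreover have "K \<noteq> {}" using assms by blast
  ultimately show ?thesis using that[of c d] by auto
qed

lemma additive_division_1:
  fixes g :: "real \<Rightarrow> 'a::real_normed_vector"
  assumes "a \<le> b" "D division_of {a..b}"
  shows "(\<Sum>K\<in>D. g (Sup K) - g (Inf K)) = g b - g a"
proof -
  \<comment> \<open>Left endpoints as tags turn the division into a tagged one, for which the
    telescoping sum is known.\<close>
  let ?p = "(\<lambda>K. (Inf K, K)) ` D"
  have "?p tagged_division_of {a..b}"
  proof (rule tagged_division_ofI)
    show "finite ?p" using assms(2) by blast
    show "\<Union>{K. \<exists>x. (x, K) \<in> ?p} = {a..b}" by (subst division_ofD(6)[OF assms(2), symmetric]) blast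
    fix x K assume "(x, K) \<in> ?p"
    then have K: "K \<in> D" "x = Inf K" by auto
    then show "x \<in> K" using division_of_real_cases[OF assms(2)] by (metis atLeastAtMost_iff order_refl)
    show "K \<subseteq> {a..b}" "\<exists>c d. K = cbox c d" using K assms(2) by blast+
    fix y L assume "(y, L) \<in> ?p" "(x, K) \<noteq> (y, L)"
    then have "L \<in> D" "K \<noteq> L" using K by auto
    then show "interior K \<inter> interior L = {}" using K assms(2) by blast
  qed
  from additive_tagged_division_1[OF assms(1) this, of g] show ?thesis
    by (subst (asm) sum.reindex) (auto simp: inj_on_def)
qed

lemma abs_continuous_on_IccE:
  assumes "abs_continuous_on_Icc a b u" "\<epsilon> > 0"
  obtains \<delta> where "\<delta> > 0" "\<forall>(n::nat) s t.
        (\<forall>i<n. a \<le> s i \<and> s i \<le> t i \<and> t i \<le> b) \<and>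
        disjoint_family_on (\<lambda>i. {s i<..<t i}) {..<n} \<and>
        (\<Sum>i<n. t i - s i) < \<delta> \<longrightarrow> (\<Sum>i<n. \<bar>u (t i) - u (s i)\<bar>) < \<epsilon>"
  using assms(1)[unfolded abs_continuous_on_Icc_def, THEN spec, THEN mp, OF assms(2)]
  by (elim exE conjE)

text \<open>Covering and gauge arguments deliver finite sets of intervals without an order.
  Enumerating such a set leads back to the indexed definition; intervals reduced to a point are
  harmless, since the definition admits \<open>s i = t i\<close>.\<close>

lemma abs_continuous_on_Icc_division:
  assumes "abs_continuous_on_Icc a b u" "\<epsilon> > 0"
  obtains \<delta> where "\<delta> > 0"
    "\<forall>D. D division_of \<Union>D \<and> \<Union>D \<subseteq> {a..b} \<and> (\<Sum>K\<in>D. measure lborel K) < \<delta>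
      \<longrightarrow> (\<Sum>K\<in>D. \<bar>u (Sup K) - u (Inf K)\<bar>) < \<epsilon>"
proof -
  obtain \<delta> where "\<delta> > 0" and \<delta>: "\<forall>(n::nat) s t.
        (\<forall>i<n. a \<le> s i \<and> s i \<le> t i \<and> t i \<le> b) \<and>
        disjoint_family_on (\<lambda>i. {s i<..<t i}) {..<n} \<and>
        (\<Sum>i<n. t i - s i) < \<delta> \<longrightarrow> (\<Sum>i<n. \<bar>u (t i) - u (s i)\<bar>) < \<epsilon>"
    by (rule abs_continuous_on_IccE[OF assms])
  show thesis
  proof (rule that[OF \<open>\<delta> > 0\<close>], intro allI impI, elim conjE)
    fix D :: "real set set"
    assume D: "D division_of \<Union>D" "\<Union>D \<subseteq> {a..b}" "(\<Sum>K\<in>D. measure lborel K) < \<delta>"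
    have "finite D" using D by blast
    then obtain h where "bij_betw h {0..<card D} D"
      using ex_bij_betw_nat_finite by blast
    then have h: "bij_betw h {..<card D} D" by (simp add: atLeast0LessThan)
    then have hD: "h i \<in> D" if "i < card D" for i
      using that by (auto simp: bij_betw_def)
    have cont: "measure lborel K = Sup K - Inf K" and int: "interior K = {Inf K<..<Sup K}" 
      and sub: "a \<le> Inf K" "Inf K \<le> Sup K" "Sup K \<le> b" if "K \<in> D" for K
    proof -
      obtain c d where *: "c \<le> d" "K = {c..d}" "Inf K = c" "Sup K = d" "measure lborel K = d - c"
        using division_of_real_cases[OF D(1) \<open>K \<in> D\<close>] by metis
      moreover have "K \<subseteq> {a..b}" using D(2) that by blast
      ultimately show "measure lborel K = Sup K - Inf K" "interior K = {Inf K<..<Sup K}"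
        "a \<le> Inf K" "Inf K \<le> Sup K" "Sup K \<le> b" by auto
    qed
    have "(\<Sum>i<card D. \<bar>u (Sup (h i)) - u (Inf (h i))\<bar>) < \<epsilon>"
    proof (rule \<delta>[rule_format], intro conjI allI impI)
      show "a \<le> Inf (h i)" "Inf (h i) \<le> Sup (h i)" "Sup (h i) \<le> b" if "i < card D" for i
        using sub[OF hD[OF that]] by auto
      have "interior (h i) \<inter> interior (h j) = {}" if "i < card D" "j < card D" "i \<noteq> j" for i j
      proof -
        have "h i \<noteq> h j" using h that by (auto simp: bij_betw_def inj_on_def)
        then show ?thesis using division_ofD(5)[OF D(1)] hD that by blast
      qed
      then show "disjoint_family_on (\<lambda>i. {Inf (h i)<..<Sup (h i)}) {..<card D}"
        unfolding disjoint_family_on_def using int hD by simp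
      have "(\<Sum>i<card D. Sup (h i) - Inf (h i)) = (\<Sum>K\<in>D. Sup K - Inf K)"
        using sum.reindex_bij_betw[OF h] by fast
      then show "(\<Sum>i<card D. Sup (h i) - Inf (h i)) < \<delta>"
        using D(3) cont by simp
    qed
    then show "(\<Sum>K\<in>D. \<bar>u (Sup K) - u (Inf K)\<bar>) < \<epsilon>"
      using sum.reindex_bij_betw[OF h, of "\<lambda>K. \<bar>u (Sup K) - u (Inf K)\<bar>"] by simp
  qed
qed

lemma locally_abs_continuous_imp_isCont:
  assumes "locally_abs_continuous u"
  shows "isCont u x"
  unfolding continuous_at_eps_delta
proof (intro allI impI)
  fix e :: real assume "e > 0"
  have "abs_continuous_on_Icc (x - 1) (x + 1) u"
    using assms by (simp add: locally_abs_continuous_def)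
  note E = abs_continuous_on_IccE[OF this \<open>e > 0\<close>]
  obtain \<delta> where "\<delta> > 0" and \<delta>: "\<forall>(n::nat) s t.
        (\<forall>i<n. x - 1 \<le> s i \<and> s i \<le> t i \<and> t i \<le> x + 1) \<and>
        disjoint_family_on (\<lambda>i. {s i<..<t i}) {..<n} \<and>
        (\<Sum>i<n. t i - s i) < \<delta> \<longrightarrow> (\<Sum>i<n. \<bar>u (t i) - u (s i)\<bar>) < e"
    by (rule E)
  have "dist (u y) (u x) < e" if "dist y x < min \<delta> 1" for y
  proof -
    have "\<bar>u (max x y) - u (min x y)\<bar> < e"
      using \<delta>[rule_format, of 1 "\<lambda>_. min x y" "\<lambda>_. max x y"] that
      by (auto simp: disjoint_family_on_def dist_real_def min_def max_def split: if_splits)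
    then show ?thesis by (cases "x \<le> y") (auto simp: dist_real_def min_def max_def)
  qed
  then show "\<exists>d>0. \<forall>x'. dist x' x < d \<longrightarrow> dist (u x') (u x) < e"
    using \<open>\<delta> > 0\<close> by (intro exI[of _ "min \<delta> 1"]) auto
qed

section \<open>Difference quotients and differentiability almost everywhere\<close>

text \<open>Up to the boundary case this says that the upper derivate at \<open>x\<close> exceeds
  \<open>c\<close>. A lower derivate below \<open>p\<close> becomes \<open>steep_at\<close> for the
  negated function at level \<open>- p\<close>, so a single notion serves both directions.\<close>

definition steep_at :: "(real \<Rightarrow> real) \<Rightarrow> real \<Rightarrow> real \<Rightarrow> bool" where
  "steep_at g c x \<longleftrightarrow> frequently (\<lambda>h. c < (g (x + h) - g x) / h) (at 0)"

text \<open>For fixed \<open>h\<close> the condition is open by continuity, so the union over all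
  small \<open>h\<close> is open although uncountable. Only the scale \<open>1 / (n + 1)\<close>
  runs through a countable set: the result is a G-delta.\<close>

lemma steep_at_sets:
  assumes "\<And>x. isCont g x"
  shows "{x. steep_at g c x} \<in> sets borel"
proof -
  let ?U = "\<lambda>n. \<Union>h\<in>{h. h \<noteq> 0 \<and> \<bar>h\<bar> < inverse (real (Suc n))}. {x. c < (g (x + h) - g x) / h}"
  have "open (?U n)" for n
  proof (intro open_UN ballI)
    fix h
    have g: "continuous_on UNIV g" using assms by (simp add: continuous_at_imp_continuous_on)
    have "continuous_on UNIV (\<lambda>x. (g (x + h) - g x) / h)"
      by (cases "h = 0") (auto intro!: continuous_intros continuous_on_compose2[OF g])
    then show "open {x. c < (g (x + h) - g x) / h}"
      by (intro open_Collect_less continuous_on_const)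
  qed
  moreover have "{x. steep_at g c x} = (\<Inter>n. ?U n)"
  proof (intro set_eqI iffI)
    fix x assume "x \<in> {x. steep_at g c x}"
    then have *: "\<And>d. d > 0 \<Longrightarrow> \<exists>h. h \<noteq> 0 \<and> \<bar>h\<bar> < d \<and> c < (g (x + h) - g x) / h"
      by (auto simp: steep_at_def frequently_at)
    show "x \<in> (\<Inter>n. ?U n)" using *[of "inverse (real (Suc n))" for n] by auto
  next
    fix x assume x: "x \<in> (\<Inter>n. ?U n)"
    have "\<exists>h. h \<noteq> 0 \<and> \<bar>h\<bar> < d \<and> c < (g (x + h) - g x) / h" if d: "d > 0" for d
    proof -
      obtain n where "inverse (real (Suc n)) < d" using reals_Archimedean[OF d] by blast
      moreover obtain h where "h \<noteq> 0" "\<bar>h\<bar> < inverse (real (Suc n))" "c < (g (x + h) - g x) / h" 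
        using x by auto
      ultimately show ?thesis by (intro exI[of _ h]) auto
    qed
    then show "x \<in> {x. steep_at g c x}" by (auto simp: steep_at_def frequently_at)
  qed
  ultimately show ?thesis by auto
qed

lemma steep_at_interval:
  assumes "steep_at g c x" "d > 0"
  obtains s t where "s < t" "x \<in> {s..t}" "t - s < d" "c * (t - s) < g t - g s"
proof -
  obtain h where h: "h \<noteq> 0" "\<bar>h\<bar> < d" "c < (g (x + h) - g x) / h"
    using assms by (auto simp: steep_at_def frequently_at)
  show thesis
  proof (cases "h > 0")
    case True
    then show ?thesis using h by (intro that[of x "x + h"]) (auto simp: field_simps)
  next
    case False
    then show ?thesis using h by (intro that[of "x + h" x]) (auto simp: field_simps)
  qed
qed

text \<open>If the lower and upper limits of the difference quotients differ, two rationals fit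
  strictly between them; if they agree, the common limit must be infinite. Rational levels are
  chosen so that the exceptional points later form a countable union.\<close>

lemma not_differentiable_imp_steep_at:
  assumes "\<not> g differentiable (at x)"
  shows "(\<exists>p\<in>\<rat>. \<exists>q\<in>\<rat>. p < q \<and> steep_at g q x \<and> steep_at (\<lambda>y. - g y) (- p) x)
    \<or> (\<forall>c. steep_at g c x) \<or> (\<forall>c. steep_at (\<lambda>y. - g y) c x)"
proof -
  define Q where "Q h = (g (x + h) - g x) / h" for h
  have neg: "(- g (x + h) - - g x) / h = - Q h" for h
    by (simp add: Q_def diff_divide_distrib)
  define l L where "l = Liminf (at 0) (\<lambda>h. ereal (Q h))" and "L = Limsup (at 0) (\<lambda>h. ereal (Q h))"
  have "l \<le> L" unfolding l_def L_def by (intro Liminf_le_Limsup) simp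
  have up: "steep_at g c x" if "ereal c < L" for c
  proof (rule ccontr)
    assume "\<not> ?thesis"
    then have "eventually (\<lambda>h. ereal (Q h) \<le> ereal c) (at 0)"
      by (simp add: steep_at_def frequently_def Q_def not_less)
    then have "L \<le> ereal c" unfolding L_def by (rule Limsup_bounded)
    then show False using that by simp
  qed
  have down: "steep_at (\<lambda>y. - g y) (- c) x" if "l < ereal c" for c
  proof (rule ccontr)
    assume "\<not> ?thesis"
    then have "eventually (\<lambda>h. ereal c \<le> ereal (Q h)) (at 0)"
      unfolding steep_at_def frequently_def neg by (simp add: not_less)
    then have "ereal c \<le> l" unfolding l_def by (rule Liminf_bounded)
    then show False using that by simp
  qed
  show ?thesis
  proof (cases "l < L")
    case True
    then obtain a where a: "l < ereal a" "ereal a < L" by (metis ereal_dense2)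
    then obtain b where b: "ereal a < ereal b" "ereal b < L" by (metis ereal_dense2)
    from a obtain a' where a': "l < ereal a'" "ereal a' < ereal a" by (metis ereal_dense2)
    \<comment> \<open>The reals \<open>a'\<close> and \<open>b\<close> keep \<open>p\<close> and
      \<open>q\<close> strictly between \<open>l\<close> and \<open>L\<close>, while
      \<open>a\<close> separates them.\<close>
    obtain p where p: "p \<in> \<rat>" "a' < p" "p < a" using a' Rats_dense_in_real[of a' a] by auto
    obtain q where q: "q \<in> \<rat>" "a < q" "q < b" using b Rats_dense_in_real[of a b] by auto
    have "ereal q < L" "l < ereal p"
      using q p a' b by (auto intro: less_trans[of _ "ereal b"] less_trans[of _ "ereal a'"])
    then have "steep_at g q x" "steep_at (\<lambda>y. - g y) (- p) x" using up down by auto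
    then show ?thesis using p q by force
  next
    case False
    then have "l = L" using \<open>l \<le> L\<close> by simp
    then have lim: "((\<lambda>h. ereal (Q h)) \<longlongrightarrow> L) (at 0)"
      by (simp add: tendsto_iff_Liminf_eq_Limsup l_def L_def)
    show ?thesis
    proof (cases L)
      case (real r)
      with lim have "(Q \<longlongrightarrow> r) (at 0)" by simp
      then have "DERIV g x :> r" unfolding DERIV_def Q_def .
      then show ?thesis using assms real_differentiable_def by blast
    next
      case PInf
      then show ?thesis using up by simp
    next
      case MInf
      then have "steep_at (\<lambda>y. - g y) (- (- c)) x" for c using \<open>l = L\<close> by (intro down) simp
      then show ?thesis by simp
    qed
  qed
qed

text \<open>The intervals inside \<open>U\<close> with slope above \<open>c\<close> form a Vitali
  cover of \<open>E\<close>. A countable disjoint subfamily misses only a null set, and since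
  \<open>E\<close> has finite measure, finitely many of its members already miss less than
  \<eta>.\<close>

lemma steep_at_Vitali:
  fixes g :: "real \<Rightarrow> real"
  assumes E: "E \<in> lmeasurable" "\<And>x. x \<in> E \<Longrightarrow> steep_at g c x"
    and U: "open U" "E \<subseteq> U" and "\<eta> > 0"
  obtains D where "finite D" "disjoint D" "\<Union>D \<subseteq> U" "measure lebesgue (E - \<Union>D) < \<eta>"
    "\<forall>K\<in>D. \<exists>s t. s < t \<and> K = {s..t} \<and> c * (t - s) < g t - g s"
proof -
  define I where "I = {(s, t). s < t \<and> {s..t} \<subseteq> U \<and> c * (t - s) < g t - g s}"
  \<comment> \<open>The covering theorem is about balls, so intervals are given by midpoint
    \<open>a\<close> and half-length \<open>r\<close>.\<close>
  define a where "a = (\<lambda>(s::real, t). (s + t) / 2)"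
  define r where "r = (\<lambda>(s::real, t). (t - s) / 2)"
  have cb: "cball (a i) (r i) = {fst i..snd i}" for i
    unfolding cball_eq_atLeastAtMost a_def r_def
    by (cases i) (simp add: field_simps)
  obtain C where C: "countable C" "C \<subseteq> I"
     "pairwise (\<lambda>i j. disjnt (cball (a i) (r i)) (cball (a j) (r j))) C"
     "negligible (E - (\<Union>i \<in> C. cball (a i) (r i)))"
  proof (rule Vitali_covering_theorem_cballs[of I r E a])
    show "0 < r i" if "i \<in> I" for i using that by (auto simp: I_def r_def)
    show "\<exists>i. i \<in> I \<and> x \<in> cball (a i) (r i) \<and> r i < d" if x: "x \<in> E" and d: "0 < d" for x d
    proof -
      obtain e where e: "e > 0" "ball x e \<subseteq> U" using U x open_contains_ball by blast
      obtain s t where st: "s < t" "x \<in> {s..t}" "t - s < min d e" "c * (t - s) < g t - g s"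
        using steep_at_interval[OF E(2)[OF x], of "min d e"] d e by auto
      have "{s..t} \<subseteq> ball x e" using st by (auto simp: dist_real_def)
      then have "(s, t) \<in> I" using st e by (auto simp: I_def)
      moreover have "x \<in> cball (a (s, t)) (r (s, t))" unfolding cb using st by simp
      moreover have "r (s, t) < d" using st by (simp add: r_def)
      ultimately show ?thesis by blast
    qed
  qed
  let ?C = "\<lambda>i. {fst i..snd i}"
  have neg: "negligible (E - (\<Union>i\<in>C. ?C i))" using C(4) by (simp add: cb)
  \<comment> \<open>An enumeration by \<open>from_nat_into\<close> requires a nonempty
    family.\<close>
  show thesis
  proof (cases "C = {}")
    case True
    then have "measure lebesgue E = 0" using neg by (simp add: negligible_imp_measure0)
    then show ?thesis using \<open>\<eta> > 0\<close> by (intro that[of "{}"]) auto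
  next
    case False
    \<comment> \<open>What the first \<open>n\<close> intervals leave uncovered; these sets decrease
      to the null remainder, and continuity from above applies.\<close>
    define A where "A n = E - (\<Union>i\<in>from_nat_into C ` {..<n}. ?C i)" for n
    have A_meas: "A n \<in> lmeasurable" for n
      unfolding A_def by (intro fmeasurable_Diff E(1) sets.finite_UN) auto
    have "(\<lambda>n. measure lebesgue (A n)) \<longlonglongrightarrow> measure lebesgue (\<Inter>n. A n)"
    proof (rule Lim_measure_decseq)
      show "range A \<subseteq> sets lebesgue" using A_meas by auto
      show "decseq A" by (rule decseq_SucI) (auto simp: A_def)
      show "emeasure lebesgue (A i) \<noteq> \<infinity>" for i using fmeasurableD2[OF A_meas] by simp
    qed
    moreover have "(\<Inter>n. A n) = E - (\<Union>i\<in>C. ?C i)"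
    proof -
      have "(\<Union>n. from_nat_into C ` {..<n}) = from_nat_into C ` (\<Union>n. {..<n})"
        by (rule image_UN[symmetric])
      also have "\<dots> = C"
        by (simp only: UN_lessThan_UNIV range_from_nat_into[OF False C(1)])
      finally have un: "(\<Union>n. from_nat_into C ` {..<n}) = C" .
      have "(\<Union>n. \<Union>i\<in>from_nat_into C ` {..<n}. ?C i) = (\<Union>i\<in>C. ?C i)"
        by (simp only: UN_UN_flatten[symmetric] un)
      then show ?thesis unfolding A_def by blast
    qed
    ultimately have "(\<lambda>n. measure lebesgue (A n)) \<longlonglongrightarrow> 0"
      using neg by (simp add: negligible_imp_measure0)
    then have "eventually (\<lambda>n. measure lebesgue (A n) < \<eta>) sequentially"
      using \<open>\<eta> > 0\<close> by (rule order_tendstoD)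
    then obtain n where n: "measure lebesgue (A n) < \<eta>"
      using eventually_happens'[OF sequentially_bot] by blast
    define D where "D = ?C ` (from_nat_into C ` {..<n})"
    have sub: "from_nat_into C ` {..<n} \<subseteq> C" using from_nat_into[OF False] by auto
    show ?thesis
    proof (rule that[of D])
      show "finite D" by (simp add: D_def)
      have D_C: "\<exists>i\<in>C. X = ?C i" if "X \<in> D" for X
        using that sub unfolding D_def by blast
      have C_I: "fst i < snd i \<and> ?C i \<subseteq> U \<and> c * (snd i - fst i) < g (snd i) - g (fst i)"
        if "i \<in> C" for i
        using subsetD[OF C(2) that] by (auto simp: I_def split: prod.splits)
      show "disjoint D"
      proof (rule pairwiseI)
        fix X Y assume XY: "X \<in> D" "Y \<in> D" "X \<noteq> Y"
        obtain i where i: "i \<in> C" "X = ?C i" using D_C[OF XY(1)] by blast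
        obtain j where j: "j \<in> C" "Y = ?C j" using D_C[OF XY(2)] by blast
        have "i \<noteq> j" using i j XY(3) by blast
        then show "disjnt X Y" using pairwiseD[OF C(3) i(1) j(1)] unfolding cb i j by simp
      qed
      show "\<Union>D \<subseteq> U"
      proof
        fix x assume "x \<in> \<Union>D"
        then obtain i where "i \<in> C" "x \<in> ?C i" using D_C by blast
        then show "x \<in> U" using C_I by blast
      qed
      show "measure lebesgue (E - \<Union>D) < \<eta>" using n by (simp add: A_def D_def)
      show "\<forall>K\<in>D. \<exists>s t. s < t \<and> K = {s..t} \<and> c * (t - s) < g t - g s"
      proof
        fix K assume "K \<in> D"
        then obtain i where "i \<in> C" "K = ?C i" using D_C by blast
        then show "\<exists>s t. s < t \<and> K = {s..t} \<and> c * (t - s) < g t - g s" using C_I by blast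
      qed
    qed
  qed
qed

lemma sum_content_disjoint_intervals:
  assumes "finite D" "disjoint D" "\<And>K. K \<in> D \<Longrightarrow> \<exists>s t. s < t \<and> K = {s..t::real}"
  shows "(\<Sum>K\<in>D. measure lborel K) = measure lebesgue (\<Union>D)" and "D division_of \<Union>D"
    and "\<Union>D \<in> lmeasurable"
proof -
  have lm: "K \<in> lmeasurable" if "K \<in> D" for K using assms(3)[OF that] by auto
  have "measure lebesgue (\<Union>K\<in>D. K) = (\<Sum>K\<in>D. measure lebesgue K)"
    using fmeasurableD[OF lm] fmeasurableD2[OF lm] assms(2)
    by (intro measure_finite_Union assms(1))
      (auto simp: disjoint_family_on_def pairwise_def disjnt_def)
  also have "\<dots> = (\<Sum>K\<in>D. measure lborel K)"
    by (rule sum.cong) (use assms(3) in fastforce)+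
  finally show "(\<Sum>K\<in>D. measure lborel K) = measure lebesgue (\<Union>D)" by simp
  show "D division_of \<Union>D"
  proof (rule division_ofI)
    show "\<exists>a b. K = cbox a b" "K \<noteq> {}" if "K \<in> D" for K
      using assms(3)[OF that] by (metis box_real(2), force)
    show "interior K \<inter> interior L = {}" if "K \<in> D" "L \<in> D" "K \<noteq> L" for K L
      using assms(2) that interior_subset unfolding pairwise_def disjnt_def by blast
  qed (use assms(1) in auto)
  show "\<Union>D \<in> lmeasurable" using lm assms(1) by (intro fmeasurable.finite_Union) auto
qed

text \<open>Disjoint intervals of slope above \<open>q\<close> exhaust \<open>E\<close> up to small measure, and inside them disjoint
  intervals of slope below \<open>p\<close> do so again. The gaps between the two families have small total length,
  so by absolute continuity both families carry almost the same increment of \<open>u\<close>.\<close>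

lemma no_crossing_slopes:
  assumes u: "locally_abs_continuous u" and E: "E \<in> sets lebesgue" "E \<subseteq> {a<..<b}"
    and pq: "p < q" and steep: "\<And>x. x \<in> E \<Longrightarrow> steep_at u q x \<and> steep_at (\<lambda>y. - u y) (- p) x"
  shows "measure lebesgue E = 0"
proof (cases "a \<le> b")
  case False
  then have "E = {}" using E(2) by auto
  then show ?thesis by simp
next
  case ab: True
  have Elm: "E \<in> lmeasurable"
    by (rule fmeasurableI2[of "{a<..<b}"]) (use E in auto)
  \<comment> \<open>The three summands on the right come from the increments over the gaps, from the
    lengths of the gaps weighted by \<open>p\<close>, and from the part of \<open>E\<close> outside
    the first family.\<close>
  have main: "(q - p) * measure lebesgue E \<le> \<epsilon> * (1 + 2 * \<bar>p\<bar> + (q - p))" if "\<epsilon> > 0" for \<epsilon>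
  proof -
    have ac: "abs_continuous_on_Icc a b u"
      using u ab by (simp add: locally_abs_continuous_def)
    obtain \<delta> where \<delta>: "\<delta> > 0"
      "\<forall>D. D division_of \<Union>D \<and> \<Union>D \<subseteq> {a..b} \<and> (\<Sum>K\<in>D. measure lborel K) < \<delta>
      \<longrightarrow> (\<Sum>K\<in>D. \<bar>u (Sup K) - u (Inf K)\<bar>) < \<epsilon>"
      by (rule abs_continuous_on_Icc_division[OF ac \<open>\<epsilon> > 0\<close>])
    \<comment> \<open>The gaps will have total length below \<open>2 * \<eta>\<close>, one \<eta>
      lying outside \<open>E\<close> and one being missed by the inner covers; hence the bound
      \<open>\<delta> / 2\<close>.\<close>
    define \<eta> where "\<eta> = min (\<delta> / 2) \<epsilon>"
    have \<eta>: "\<eta> > 0" "2 * \<eta> \<le> \<delta>" "\<eta> \<le> \<epsilon>" using \<delta>(1) \<open>\<epsilon> > 0\<close> by (auto simp: \<eta>_def min_def)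
    obtain T where T: "open T" "E \<subseteq> T" "T - E \<in> lmeasurable" "emeasure lebesgue (T - E) < ennreal \<eta>"
      using sets_lebesgue_outer_open[OF E(1) \<eta>(1)] .
    define U where "U = T \<inter> {a<..<b}"
    have U: "open U" "E \<subseteq> U" "U \<subseteq> {a<..<b}" using T E by (auto simp: U_def)
    have Ulm: "U \<in> lmeasurable"
      by (rule fmeasurableI2[of "{a<..<b}"]) (use U in auto)
    have "measure lebesgue (T - E) < \<eta>"
      using T(4) \<eta>(1) by (simp add: emeasure_eq_measure2[OF T(3)] ennreal_less_iff)
    moreover have "measure lebesgue (U - E) \<le> measure lebesgue (T - E)"
      using T Ulm Elm by (intro measure_mono_fmeasurable) (auto simp: U_def)
    ultimately have UE: "measure lebesgue (U - E) < \<eta>" by simp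
    obtain D where D: "finite D" "disjoint D" "\<Union>D \<subseteq> U" "measure lebesgue (E - \<Union>D) < \<eta>"
      and Dq: "\<forall>K\<in>D. \<exists>s t. s < t \<and> K = {s..t} \<and> q * (t - s) < u t - u s"
      by (rule steep_at_Vitali[OF Elm conjunct1[OF steep] U(1,2) \<eta>(1)])
    have Dint: "\<And>K. K \<in> D \<Longrightarrow> \<exists>s t. s < t \<and> K = {s..t}" using Dq by blast
    note Dsum = sum_content_disjoint_intervals[OF D(1,2) Dint]
    \<comment> \<open>An equal share of \<eta> for each outer interval; the added 1 covers an empty
      \<open>D\<close>.\<close>
    define \<eta>' where "\<eta>' = \<eta> / (1 + card D)"
    have \<eta>': "\<eta>' > 0" "card D * \<eta>' \<le> \<eta>" using \<eta>(1) by (auto simp: \<eta>'_def field_simps)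
    have exB: "\<exists>B. finite B \<and> disjoint B \<and> \<Union>B \<subseteq> interior K \<and> measure lebesgue (E \<inter> interior K - \<Union>B) < \<eta>' \<and>
        (\<forall>J\<in>B. \<exists>s t. s < t \<and> J = {s..t} \<and> u t - u s < p * (t - s))" (is "\<exists>B. ?P K B") if "K \<in> D" for K
    proof -
      have "E \<inter> interior K \<in> lmeasurable"
        by (intro fmeasurable_Int_fmeasurable Elm borel_open sets_completionI_sets) auto
      then obtain B where "finite B" "disjoint B" "\<Union>B \<subseteq> interior K" "measure lebesgue (E \<inter> interior K - \<Union>B) < \<eta>'"
        "\<forall>J\<in>B. \<exists>s t. s < t \<and> J = {s..t} \<and> - p * (t - s) < - u t - - u s"
        by (rule steep_at_Vitali[OF _ conjunct2[OF steep[OF IntD1]] open_interior Int_lower2 \<eta>'(1)])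
      moreover have "(- p * (t - s) < - u t - - u s) = (u t - u s < p * (t - s))" for s t by auto
      ultimately show ?thesis by (intro exI[of _ B]) simp
    qed
    have "\<exists>B. \<forall>K\<in>D. ?P K (B K)" by (intro bchoice ballI exB)
    then obtain B where "\<forall>K\<in>D. ?P K (B K)" by (rule exE)
    note B = this[rule_format]
    note B' = B[THEN conjunct1] B[THEN conjunct2, THEN conjunct1] B[THEN conjunct2, THEN conjunct2, THEN conjunct1]
      B[THEN conjunct2, THEN conjunct2, THEN conjunct2, THEN conjunct1]
    note B_steep = B[THEN conjunct2, THEN conjunct2, THEN conjunct2, THEN conjunct2, THEN bspec]
    have Bint: "\<exists>s t. s < t \<and> J = {s..t}" if "K \<in> D" "J \<in> B K" for K J
      using B_steep[OF that] by blast
    have Bsum: "(\<Sum>J\<in>B K. measure lborel J) = measure lebesgue (\<Union>(B K))" "B K division_of \<Union>(B K)"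
      "\<Union>(B K) \<in> lmeasurable" if "K \<in> D" for K
      using sum_content_disjoint_intervals[OF B'(1,2) Bint, OF that that that] by auto
    \<comment> \<open>Completing \<open>B K\<close> to a division of \<open>K\<close> makes the gaps
      explicit: they are the members of \<open>G K - B K\<close>.\<close>
    have "\<exists>G. B K \<subseteq> G \<and> G division_of K" if K: "K \<in> D" for K
    proof -
      obtain s t where st: "s < t" "K = {s..t}" using Dint[OF K] by blast
      have "\<Union>(B K) \<subseteq> cbox s t" using B'(3)[OF K] interior_subset st by auto
      then obtain G where "B K \<subseteq> G" "G division_of cbox s t"
        using partial_division_extend_interval[OF Bsum(2)[OF K]] by blast
      then show ?thesis using st by auto
    qed
    then obtain G where G: "\<And>K. K \<in> D \<Longrightarrow> B K \<subseteq> G K \<and> G K division_of K" by metis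
    then have G1: "\<And>K. K \<in> D \<Longrightarrow> B K \<subseteq> G K" and G2: "\<And>K. K \<in> D \<Longrightarrow> G K division_of K" by blast+
    have Gsum: "(\<Sum>J\<in>G K. g (Sup J) - g (Inf J)) = g (Sup K) - g (Inf K)" if K: "K \<in> D" for K and g :: "real \<Rightarrow> real"
    proof -
      obtain s t where st: "s < t" "K = {s..t}" using Dint[OF K] by blast
      then show ?thesis using additive_division_1[of s t "G K" g] G2[OF K] by simp
    qed
    define H where "H = (\<Union>K\<in>D. G K - B K)"
    have GK: "J \<subseteq> K" "J \<noteq> {}" if "K \<in> D" "J \<in> G K" for J K
      by (rule division_ofD(2,3)[OF G2[OF that(1)] that(2)])+
    have Hsum: "(\<Sum>J\<in>H. g J) = (\<Sum>K\<in>D. (\<Sum>J\<in>G K. g J) - (\<Sum>J\<in>B K. g J))" for g :: "real set \<Rightarrow> real"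
    proof -
      have fin: "finite (G K)" if "K \<in> D" for K using division_ofD(1)[OF G2[OF that]] .
      have "(\<Sum>J\<in>H. g J) = (\<Sum>K\<in>D. \<Sum>J\<in>G K - B K. g J)"
        unfolding H_def
      proof (rule sum.UNION_disjoint)
        show "\<forall>K\<in>D. \<forall>L\<in>D. K \<noteq> L \<longrightarrow> (G K - B K) \<inter> (G L - B L) = {}"
        proof (intro ballI impI)
          fix K L assume KL: "K \<in> D" "L \<in> D" "K \<noteq> L"
          then have "K \<inter> L = {}" using pairwiseD[OF D(2) KL] by (simp add: disjnt_def)
          then have "J \<notin> G L" if "J \<in> G K" for J
            using GK(1,2)[OF KL(1) that] GK(1)[OF KL(2), of J] by blast
          then show "(G K - B K) \<inter> (G L - B L) = {}" by blast
        qed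
      qed (simp_all add: D(1) fin)
      also have "\<dots> = (\<Sum>K\<in>D. (\<Sum>J\<in>G K. g J) - (\<Sum>J\<in>B K. g J))"
        by (intro sum.cong[OF refl] sum_diff fin G1)
      finally show ?thesis .
    qed
    have Hdiv: "H division_of \<Union>H"
    proof (rule division_ofI)
      show "finite H" unfolding H_def using D(1) division_ofD(1)[OF G2] by auto
      show "K \<noteq> {}" "\<exists>a b. K = cbox a b" if K: "K \<in> H" for K
      proof -
        obtain L where L: "L \<in> D" "K \<in> G L" using K by (auto simp: H_def)
        then show "K \<noteq> {}" "\<exists>a b. K = cbox a b"
          using division_ofD(3,4)[OF G2[OF L(1)] L(2)] by auto
      qed
      show "interior J \<inter> interior J' = {}" if JJ: "J \<in> H" "J' \<in> H" "J \<noteq> J'" for J J'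
      proof -
        obtain K K' where K: "K \<in> D" "J \<in> G K" "K' \<in> D" "J' \<in> G K'"
          using JJ(1,2) unfolding H_def by blast
        show ?thesis
        proof (cases "K = K'")
          case True
          then show ?thesis using division_ofD(5)[OF G2[OF K(1)]] K JJ(3) by blast
        next
          case False
          then have "K \<inter> K' = {}" using pairwiseD[OF D(2) K(1,3)] by (simp add: disjnt_def)
          moreover have "J \<subseteq> K" "J' \<subseteq> K'" using GK K by auto
          ultimately show ?thesis using interior_subset[of J] interior_subset[of J'] by blast
        qed
      qed
    qed auto
    have Hsub: "\<Union>H \<subseteq> {a..b}"
    proof -
      have "\<Union>H \<subseteq> \<Union>D" unfolding H_def using GK(1) by fast
      also have "\<dots> \<subseteq> U" by (rule D(3))
      also have "\<dots> \<subseteq> {a..b}" using U(3) greaterThanLessThan_subseteq_atLeastAtMost_iff by auto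
      finally show ?thesis .
    qed
    have mG: "(\<Sum>J\<in>G K. measure lborel J) = measure lborel K" if K: "K \<in> D" for K
    proof -
      obtain s t where st: "s < t" "K = {s..t}" using Dint[OF K] by blast
      have "G K division_of cbox s t" using G2[OF K] st by simp
      from additive_content_division[OF this] show ?thesis using st by simp
    qed
    \<comment> \<open>Up to endpoints, a point of \<open>K\<close> outside the inner family lies in
      \<open>K - E\<close> or in the small part of \<open>E\<close> that the inner family misses.
      The sets \<open>K - E\<close> are disjoint subsets of \<open>U - E\<close>, so their measures
      add up to less than \<eta>.\<close>
    have lenH: "(\<Sum>J\<in>H. measure lborel J) < 2 * \<eta>"
    proof -
      have "(\<Sum>J\<in>H. measure lborel J) = (\<Sum>K\<in>D. measure lborel K - measure lebesgue (\<Union>(B K)))"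
        unfolding Hsum by (intro sum.cong refl) (simp add: mG Bsum)
      also have "\<dots> \<le> (\<Sum>K\<in>D. measure lebesgue (K - E) + \<eta>')"
      proof (rule sum_mono)
        fix K assume K: "K \<in> D"
        then obtain s t where st: "s < t" "K = {s..t}" using Dint by blast
        have m: "K - E \<in> lmeasurable" "E \<inter> interior K - \<Union>(B K) \<in> lmeasurable"
          "\<Union>(B K) \<in> lmeasurable" "interior K \<in> sets lebesgue"
          using Elm Bsum(3)[OF K]
          by (auto simp: st intro!: fmeasurable_Diff fmeasurable_Int_fmeasurable)
        have "measure lborel K = measure lebesgue (interior K)" using st by simp
        also have "\<dots> \<le> measure lebesgue ((K - E) \<union> ((E \<inter> interior K - \<Union>(B K)) \<union> \<Union>(B K)))"
          using m interior_subset[of K] by (intro measure_mono_fmeasurable fmeasurable.Un) auto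
        also have "\<dots> \<le> measure lebesgue (K - E) + (measure lebesgue (E \<inter> interior K - \<Union>(B K)) + measure lebesgue (\<Union>(B K)))"
          using m by (intro order_trans[OF measure_Un_le] add_left_mono measure_Un_le sets.Un) auto
        finally show "measure lborel K - measure lebesgue (\<Union>(B K)) \<le> measure lebesgue (K - E) + \<eta>'"
          using B'(4)[OF K] by linarith
      qed
      also have "\<dots> = (\<Sum>K\<in>D. measure lebesgue (K - E)) + card D * \<eta>'" by (simp add: sum.distrib)
      also have "(\<Sum>K\<in>D. measure lebesgue (K - E)) = measure lebesgue (\<Union>K\<in>D. K - E)"
      proof (rule measure_finite_Union[symmetric])
        have KE: "K - E \<in> lmeasurable" if "K \<in> D" for K
          using Dint[OF that] Elm by (auto intro!: fmeasurable_Diff)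
        show "(\<lambda>K. K - E) ` D \<subseteq> sets lebesgue" "\<And>K. K \<in> D \<Longrightarrow> emeasure lebesgue (K - E) \<noteq> \<infinity>"
          using KE fmeasurableD2[OF KE] by auto
        show "disjoint_family_on (\<lambda>K. K - E) D"
          using D(2) by (auto simp: pairwise_def disjnt_def disjoint_family_on_def)
      qed (rule D(1))
      also have "\<dots> \<le> measure lebesgue (U - E)"
        using D(3) Ulm Elm Dsum(3) by (intro measure_mono_fmeasurable fmeasurable_Diff) (auto simp: UN_extend_simps)
      finally show ?thesis using UE \<eta>' by linarith
    qed
    have smallH: "(\<Sum>J\<in>H. \<bar>u (Sup J) - u (Inf J)\<bar>) < \<epsilon>"
      using \<delta>(2)[rule_format, of H] Hdiv Hsub lenH \<eta> by simp
    define S1 where "S1 = (\<Sum>K\<in>D. measure lborel K)"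
    define S2 where "S2 = (\<Sum>K\<in>D. \<Sum>J\<in>B K. measure lborel J)"
    have S12: "S1 - S2 < 2 * \<eta>" using lenH by (simp add: Hsum S1_def S2_def sum_subtractf mG)
    have S21: "S1 - S2 \<ge> 0"
    proof -
      have "0 \<le> (\<Sum>J\<in>H. measure lborel J)" by (intro sum_nonneg) auto
      then show ?thesis by (simp add: Hsum S1_def S2_def sum_subtractf mG)
    qed
    \<comment> \<open>The increment over the outer intervals is at least \<open>q * S1\<close>, but
      it is also at most \<open>p * S2\<close> from the inner intervals plus \<epsilon> from the
      gaps. As \<open>S1\<close> and \<open>S2\<close> nearly agree, \<open>S1\<close> must be
      small.\<close>
    have "q * S1 \<le> (\<Sum>K\<in>D. u (Sup K) - u (Inf K))"
      unfolding S1_def sum_distrib_left by (intro sum_mono) (use Dq in fastforce)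
    also have "\<dots> = (\<Sum>K\<in>D. \<Sum>J\<in>B K. u (Sup J) - u (Inf J)) + (\<Sum>J\<in>H. u (Sup J) - u (Inf J))"
      unfolding Hsum by (simp add: Gsum flip: sum.distrib)
    also have "(\<Sum>J\<in>H. u (Sup J) - u (Inf J)) \<le> (\<Sum>J\<in>H. \<bar>u (Sup J) - u (Inf J)\<bar>)"
      by (intro sum_mono) simp
    also have "\<dots> \<le> \<epsilon>" using smallH by simp
    also have "(\<Sum>K\<in>D. \<Sum>J\<in>B K. u (Sup J) - u (Inf J)) \<le> p * S2"
      unfolding S2_def sum_distrib_left by (intro sum_mono) (use B_steep in fastforce)
    finally have "q * S1 \<le> p * S2 + \<epsilon>" by simp
    then have "(q - p) * S1 \<le> - p * (S1 - S2) + \<epsilon>" by (simp add: algebra_simps)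
    also have "- p * (S1 - S2) \<le> \<bar>p\<bar> * (2 * \<eta>)"
      using S12 S21 by (intro mult_mono) auto
    finally have *: "(q - p) * S1 \<le> 2 * \<bar>p\<bar> * \<eta> + \<epsilon>" by simp
    have "measure lebesgue E \<le> measure lebesgue ((E - \<Union>D) \<union> \<Union>D)"
      using Elm Dsum(3) by (intro measure_mono_fmeasurable) auto
    also have "\<dots> \<le> measure lebesgue (E - \<Union>D) + measure lebesgue (\<Union>D)"
      using Elm Dsum(3) by (intro measure_Un_le) auto
    finally have "measure lebesgue E \<le> \<eta> + S1" using D(4) Dsum(1) by (simp add: S1_def)
    then have "(q - p) * measure lebesgue E \<le> (q - p) * \<eta> + (q - p) * S1"
      using pq by (simp flip: distrib_left)
    also have "\<dots> \<le> (q - p) * \<epsilon> + (2 * \<bar>p\<bar> * \<epsilon> + \<epsilon>)"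
      using * \<eta>(3) pq by (intro add_mono order_trans[OF *] mult_left_mono) auto
    finally show ?thesis by (simp add: algebra_simps)
  qed
  show ?thesis
  proof (rule ccontr)
    assume "measure lebesgue E \<noteq> 0"
    then have pos: "(q - p) * measure lebesgue E > 0" using pq by (simp add: zero_less_measure_iff)
    \<comment> \<open>Inserted into \<open>main\<close>, the value below makes a positive number at
      most half of itself.\<close>
    define C where "C = 1 + 2 * \<bar>p\<bar> + (q - p)"
    have "C > 0" using pq by (simp add: C_def)
    with main[of "(q - p) * measure lebesgue E / (2 * C)"] pos show False
      by (simp add: C_def[symmetric])
  qed
qed

text \<open>A local Lipschitz bound is enough, because \<open>u\<close> maps a compact interval into
  a bounded one on which a single constant works. This admits powers, which are not globally
  Lipschitz.\<close>

lemma locally_abs_continuous_compose: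
  assumes u: "locally_abs_continuous u"
    and L: "\<And>R. \<exists>L>0. \<forall>s\<in>{-R..R}. \<forall>t\<in>{-R..R}. \<bar>\<phi> s - \<phi> t\<bar> \<le> L * \<bar>s - t\<bar>"
  shows "locally_abs_continuous (\<lambda>x. \<phi> (u x))"
  unfolding locally_abs_continuous_def abs_continuous_on_Icc_def
proof (intro allI impI)
  fix a b \<epsilon> :: real
  assume ab: "a \<le> b" and \<epsilon>: "\<epsilon> > 0"
  have "continuous_on {a..b} u"
    using locally_abs_continuous_imp_isCont[OF u] by (simp add: continuous_at_imp_continuous_on)
  then have "compact (u ` {a..b})" by (rule compact_continuous_image) simp
  then have "bounded (u ` {a..b})" by (rule compact_imp_bounded)
  then obtain R where R: "\<forall>y\<in>u ` {a..b}. norm y \<le> R" by (auto simp: bounded_iff)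
  have uR: "u x \<in> {-R..R}" if "x \<in> {a..b}" for x
    using bspec[OF R imageI[OF that]] by auto
  obtain K where K: "K > 0" "\<forall>s\<in>{-R..R}. \<forall>t\<in>{-R..R}. \<bar>\<phi> s - \<phi> t\<bar> \<le> K * \<bar>s - t\<bar>"
    using L by blast
  have ac: "abs_continuous_on_Icc a b u" using u ab by (simp add: locally_abs_continuous_def)
  have "\<epsilon> / K > 0" using \<epsilon> K(1) by simp
  then obtain \<delta> where \<delta>: "\<delta> > 0" "\<forall>(n::nat) s t.
        (\<forall>i<n. a \<le> s i \<and> s i \<le> t i \<and> t i \<le> b) \<and>
        disjoint_family_on (\<lambda>i. {s i<..<t i}) {..<n} \<and>
        (\<Sum>i<n. t i - s i) < \<delta> \<longrightarrow> (\<Sum>i<n. \<bar>u (t i) - u (s i)\<bar>) < \<epsilon> / K"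
    by (rule abs_continuous_on_IccE[OF ac])
  show "\<exists>\<delta>>0. \<forall>(n::nat) s t.
        (\<forall>i<n. a \<le> s i \<and> s i \<le> t i \<and> t i \<le> b) \<and>
        disjoint_family_on (\<lambda>i. {s i<..<t i}) {..<n} \<and>
        (\<Sum>i<n. t i - s i) < \<delta> \<longrightarrow> (\<Sum>i<n. \<bar>\<phi> (u (t i)) - \<phi> (u (s i))\<bar>) < \<epsilon>"
  proof (rule exI, rule conjI[OF \<delta>(1)], intro allI impI)
    fix n :: nat and s t :: "nat \<Rightarrow> real"
    assume *: "(\<forall>i<n. a \<le> s i \<and> s i \<le> t i \<and> t i \<le> b) \<and>
        disjoint_family_on (\<lambda>i. {s i<..<t i}) {..<n} \<and> (\<Sum>i<n. t i - s i) < \<delta>"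
    have "(\<Sum>i<n. \<bar>\<phi> (u (t i)) - \<phi> (u (s i))\<bar>) \<le> (\<Sum>i<n. K * \<bar>u (t i) - u (s i)\<bar>)"
    proof (rule sum_mono)
      fix i assume "i \<in> {..<n}"
      then have "s i \<in> {a..b}" "t i \<in> {a..b}" using * by force+
      then show "\<bar>\<phi> (u (t i)) - \<phi> (u (s i))\<bar> \<le> K * \<bar>u (t i) - u (s i)\<bar>"
        using K(2) uR by blast
    qed
    also have "\<dots> < \<epsilon>"
      using \<delta>(2)[rule_format, OF *] K(1) by (simp add: field_simps flip: sum_distrib_left)
    finally show "(\<Sum>i<n. \<bar>\<phi> (u (t i)) - \<phi> (u (s i))\<bar>) < \<epsilon>" .
  qed
qed

text \<open>On a short neighbourhood absolute continuity bounds the total increment over disjoint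
  intervals by 1. Intervals of arbitrarily large slope then have arbitrarily small total length, yet
  they cover nearly all of the set.\<close>

lemma no_infinite_slope:
  assumes u: "locally_abs_continuous u" and E: "E \<in> sets lebesgue"
    and steep: "\<And>x c. x \<in> E \<Longrightarrow> steep_at u c x"
  shows "negligible E"
proof (subst locally_negligible_alt, rule ballI)
  fix x assume x: "x \<in> E"
  have ac: "abs_continuous_on_Icc (x - 1) (x + 1) u"
    using u by (simp add: locally_abs_continuous_def)
  obtain \<delta> where \<delta>: "\<delta> > 0"
    "\<forall>D. D division_of \<Union>D \<and> \<Union>D \<subseteq> {x - 1..x + 1} \<and> (\<Sum>K\<in>D. measure lborel K) < \<delta>
      \<longrightarrow> (\<Sum>K\<in>D. \<bar>u (Sup K) - u (Inf K)\<bar>) < 1"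
    by (rule abs_continuous_on_Icc_division[OF ac zero_less_one])
  \<comment> \<open>The whole ball has length \<open>2 * r < \<delta>\<close>, so every disjoint
    family inside it is short enough.\<close>
  define r where "r = min 1 (\<delta> / 3)"
  have r: "r > 0" "r \<le> 1" "2 * r < \<delta>" using \<delta>(1) by (auto simp: r_def min_def)
  define F where "F = E \<inter> ball x r"
  have Flm: "F \<in> lmeasurable"
    unfolding F_def by (rule fmeasurableI2[OF lmeasurable_ball Int_lower2 sets.Int[OF E]]) simp
  have "measure lebesgue F \<le> 0 + e" if "e > 0" for e
  proof -
    have pos: "e / 2 > 0" using that by simp
    \<comment> \<open>Slope above \<open>2 / e\<close> with total increment below 1 forces a total
      length below \<open>e / 2\<close>; the other half of \<open>e\<close> pays for the uncovered
      part.\<close>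
    have F_steep: "\<And>y. y \<in> F \<Longrightarrow> steep_at u (2 / e) y" by (rule steep) (simp add: F_def)
    have Fsub: "F \<subseteq> ball x r" by (simp add: F_def)
    obtain D where D: "finite D" "disjoint D" "\<Union>D \<subseteq> ball x r" "measure lebesgue (F - \<Union>D) < e / 2"
      and Dq: "\<forall>K\<in>D. \<exists>s t. s < t \<and> K = {s..t} \<and> 2 / e * (t - s) < u t - u s"
      by (rule steep_at_Vitali[OF Flm F_steep open_ball Fsub pos])
    have "\<And>K. K \<in> D \<Longrightarrow> \<exists>s t. s < t \<and> K = {s..t}" using Dq by blast
    note Dsum = sum_content_disjoint_intervals[OF D(1,2) this]
    have "measure lebesgue (\<Union>D) \<le> measure lebesgue (ball x r)"
      using Dsum(3) by (intro measure_mono_fmeasurable D(3)) auto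
    also have "\<dots> = 2 * r" using r by (simp add: ball_eq_greaterThanLessThan)
    finally have "(\<Sum>K\<in>D. measure lborel K) < \<delta>" using r Dsum(1) by simp
    moreover have "ball x r \<subseteq> {x - 1..x + 1}"
      using r(2) by (auto simp: ball_eq_greaterThanLessThan)
    then have "\<Union>D \<subseteq> {x - 1..x + 1}" using D(3) by (rule order_trans[rotated])
    ultimately have less1: "(\<Sum>K\<in>D. \<bar>u (Sup K) - u (Inf K)\<bar>) < 1"
      by (intro \<delta>(2)[rule_format] conjI Dsum(2))
    have "2 / e * measure lebesgue (\<Union>D) = (\<Sum>K\<in>D. 2 / e * measure lborel K)"
      by (simp only: Dsum(1)[symmetric] sum_distrib_left)
    also have "\<dots> \<le> (\<Sum>K\<in>D. \<bar>u (Sup K) - u (Inf K)\<bar>)"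
    proof (rule sum_mono)
      fix K assume "K \<in> D"
      then obtain s t where "s < t" "K = {s..t}" "2 / e * (t - s) < u t - u s" using Dq by blast
      then show "2 / e * measure lborel K \<le> \<bar>u (Sup K) - u (Inf K)\<bar>" by simp
    qed
    finally have "2 / e * measure lebesgue (\<Union>D) < 1" using less1 by simp
    then have "measure lebesgue (\<Union>D) < e / 2" using that by (simp add: field_simps)
    moreover have "measure lebesgue F \<le> measure lebesgue ((F - \<Union>D) \<union> \<Union>D)"
      using Flm Dsum(3) by (intro measure_mono_fmeasurable) auto
    moreover have "\<dots> \<le> measure lebesgue (F - \<Union>D) + measure lebesgue (\<Union>D)"
      using Flm Dsum(3) by (intro measure_Un_le) auto
    ultimately show ?thesis using D(4) by simp
  qed
  then have "measure lebesgue F \<le> 0" by (rule field_le_epsilon)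
  then have "negligible F"
    using Flm by (simp add: negligible_iff_measure measure_le_0_iff)
  then show "\<exists>U. openin (top_of_set E) U \<and> x \<in> U \<and> negligible U"
    using x r(1) unfolding F_def by (intro exI[of _ "E \<inter> ball x r"] conjI openin_open_Int) auto
qed

lemma steep_at_mono: "steep_at g c x \<Longrightarrow> d \<le> c \<Longrightarrow> steep_at g d x"
  unfolding steep_at_def by (erule frequently_elim1) simp

lemma negligible_all_steep:
  assumes "locally_abs_continuous u"
  shows "negligible {x. \<forall>c. steep_at u c x}"
proof (rule no_infinite_slope[OF assms])
  have "{x. \<forall>c. steep_at u c x} = (\<Inter>n. {x. steep_at u (real n) x})"
  proof (intro set_eqI iffI)
    fix x assume x: "x \<in> (\<Inter>n. {x. steep_at u (real n) x})"
    have "steep_at u c x" for c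
    proof -
      obtain n where "c \<le> real n" using real_arch_simple by blast
      then show ?thesis using x by (auto intro: steep_at_mono)
    qed
    then show "x \<in> {x. \<forall>c. steep_at u c x}" by simp
  qed auto
  also have "\<dots> \<in> sets borel"
    using steep_at_sets[OF locally_abs_continuous_imp_isCont[OF assms]] by (intro sets.countable_INT) auto
  finally show "{x. \<forall>c. steep_at u c x} \<in> sets lebesgue" by simp
qed auto

theorem negligible_not_differentiable:
  assumes u: "locally_abs_continuous u"
  shows "negligible {x. \<not> u differentiable (at x)}"
proof -
  have neg: "locally_abs_continuous (\<lambda>x. - u x)"
    by (rule locally_abs_continuous_compose[OF u]) (auto intro!: exI[of _ 1])
  let ?S = "\<lambda>p q. {x. steep_at u q x \<and> steep_at (\<lambda>y. - u y) (- p) x}"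
  have "negligible (?S p q)" if "p < q" for p q
  proof -
    have S: "?S p q \<in> sets borel"
      unfolding Collect_conj_eq
      by (intro sets.Int steep_at_sets locally_abs_continuous_imp_isCont u neg)
    \<comment> \<open>\<open>no_crossing_slopes\<close> concerns bounded sets, hence the exhaustion
      by bounded intervals.\<close>
    have "negligible (?S p q \<inter> {-real n<..<real n})" for n
    proof -
      have *: "?S p q \<inter> {-real n<..<real n} \<in> sets lebesgue"
        by (intro sets.Int sets_completionI_sets) (simp_all only: sets_lborel S borel_open open_greaterThanLessThan)
      have "measure lebesgue (?S p q \<inter> {-real n<..<real n}) = 0"
        by (rule no_crossing_slopes[OF u * Int_lower2 that]) simp
      moreover have "?S p q \<inter> {-real n<..<real n} \<in> lmeasurable"
        by (rule fmeasurableI2[OF _ Int_lower2 *]) simp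
      ultimately show ?thesis by (simp add: negligible_iff_measure)
    qed
    then have "negligible (\<Union>n::nat. ?S p q \<inter> {-real n<..<real n})"
      by (intro negligible_Union_nat)
    moreover have "?S p q \<subseteq> (\<Union>n::nat. ?S p q \<inter> {-real n<..<real n})"
    proof
      fix x assume x: "x \<in> ?S p q"
      obtain n where "\<bar>x\<bar> < real n" using reals_Archimedean2 by blast
      then have "x \<in> {-real n<..<real n}" by auto
      with x show "x \<in> (\<Union>n::nat. ?S p q \<inter> {-real n<..<real n})" by blast
    qed
    ultimately show ?thesis by (rule negligible_subset)
  qed
  then have "negligible (\<Union>(p, q)\<in>{(p, q). p \<in> \<rat> \<and> q \<in> \<rat> \<and> p < q}. ?S p q)"
    by (intro negligible_countable_Union countable_image countable_subset[OF _ countable_SIGMA[OF countable_rat countable_rat]])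
      auto
  then have "negligible ((\<Union>(p, q)\<in>{(p, q). p \<in> \<rat> \<and> q \<in> \<rat> \<and> p < q}. ?S p q)
      \<union> ({x. \<forall>c. steep_at u c x} \<union> {x. \<forall>c. steep_at (\<lambda>y. - u y) c x}))"
    by (intro negligible_Un negligible_all_steep u neg)
  then show ?thesis
  proof (rule negligible_subset, intro subsetI)
    fix x assume "x \<in> {x. \<not> u differentiable (at x)}"
    then have "\<not> u differentiable (at x)" by simp
    from not_differentiable_imp_steep_at[OF this]
    show "x \<in> (\<Union>(p, q)\<in>{(p, q). p \<in> \<rat> \<and> q \<in> \<rat> \<and> p < q}. ?S p q)
      \<union> ({x. \<forall>c. steep_at u c x} \<union> {x. \<forall>c. steep_at (\<lambda>y. - u y) c x})"
      by blast
  qed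
qed

section \<open>The fundamental theorem of calculus\<close>

text \<open>The gauge integral needs neither measurability nor a majorant of the derivative.
  Intervals tagged at a point of differentiability are handled by linear approximation; those tagged
  in the exceptional null set lie in an open set of small measure, where absolute continuity bounds
  their increments.\<close>

theorem deriv_has_integral:
  assumes u: "locally_abs_continuous u" and ab: "a \<le> b"
  shows "(deriv u has_integral (u b - u a)) {a..b}"
proof -
  define N where "N = {x. \<not> u differentiable (at x)}"
  have N: "negligible N" unfolding N_def by (rule negligible_not_differentiable[OF u])
  \<comment> \<open>With value 0 on \<open>N\<close>, tags in \<open>N\<close> contribute nothing to
    the Riemann sum and only the increments of \<open>u\<close> remain there.\<close>
  define v where "v x = (if x \<in> N then 0 else deriv u x)" for x
  have "(v has_integral (u b - u a)) {a..b}"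
    unfolding has_integral_real
  proof (intro allI impI)
    fix e :: real assume e: "e > 0"
    have ac: "abs_continuous_on_Icc a b u"
      using u ab by (simp add: locally_abs_continuous_def)
    obtain \<delta> where \<delta>: "\<delta> > 0"
      "\<forall>D. D division_of \<Union>D \<and> \<Union>D \<subseteq> {a..b} \<and> (\<Sum>K\<in>D. measure lborel K) < \<delta>
        \<longrightarrow> (\<Sum>K\<in>D. \<bar>u (Sup K) - u (Inf K)\<bar>) < e / 2"
      using half_gt_zero[OF e] by (rule abs_continuous_on_Icc_division[OF ac])
    obtain T where T: "open T" "N \<subseteq> T" "T \<in> lmeasurable" "measure lebesgue T < \<delta>"
    proof -
      have Nlm: "N \<in> lmeasurable" using N by (rule negligible_imp_measurable)
      obtain T where T: "open T" "N \<subseteq> T" "T - N \<in> lmeasurable" "emeasure lebesgue (T - N) < ennreal \<delta>"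
        using sets_lebesgue_outer_open[OF fmeasurableD[OF Nlm] \<delta>(1)] .
      have TN: "T = (T - N) \<union> N" using T(2) by blast
      have "measure lebesgue T \<le> measure lebesgue (T - N) + measure lebesgue N"
        by (subst TN, rule measure_Un_le) (use T(3) Nlm in auto)
      also have "\<dots> < \<delta>"
        using T(4) \<delta>(1) N by (simp add: negligible_imp_measure0 emeasure_eq_measure2[OF T(3)] ennreal_less_iff)
      finally have "measure lebesgue T < \<delta>" .
      moreover have "T \<in> lmeasurable" by (subst TN, rule fmeasurable.Un[OF T(3) Nlm])
      ultimately show thesis using T(1,2) by (intro that)
    qed
    \<comment> \<open>The added 1 keeps the denominator positive when \<open>a = b\<close>.\<close>
    define e' where "e' = e / (2 * (b - a) + 1)"
    have e': "e' > 0" "e' * (b - a) < e / 2"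
      using e ab by (auto simp: e'_def field_simps)
    have "\<exists>d>0. (x \<in> N \<longrightarrow> ball x d \<subseteq> T) \<and>
        (x \<notin> N \<longrightarrow> (\<forall>y. \<bar>y - x\<bar> < d \<longrightarrow> \<bar>u y - u x - (y - x) * v x\<bar> \<le> e' * \<bar>y - x\<bar>))" for x
    proof (cases "x \<in> N")
      case True
      then obtain d where "d > 0" "ball x d \<subseteq> T" using T(1,2) open_contains_ball by blast
      then show ?thesis using True by blast
    next
      case False
      then have "u differentiable (at x)" by (simp add: N_def)
      then have "(u has_real_derivative v x) (at x)"
        using False by (simp add: v_def DERIV_deriv_iff_real_differentiable)
      then have "(u has_derivative (\<lambda>h. v x * h)) (at x)"
        by (simp add: has_field_derivative_def)
      then obtain d where "d > 0"
        "\<forall>y. norm (y - x) < d \<longrightarrow> norm (u y - u x - v x * (y - x)) \<le> e' * norm (y - x)"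
        using e'(1) unfolding has_derivative_within_alt by (metis UNIV_I)
      then show ?thesis using False by (auto simp: mult.commute)
    qed
    then obtain d where d: "\<And>x. d x > 0" "\<And>x. x \<in> N \<Longrightarrow> ball x (d x) \<subseteq> T"
      "\<And>x y. \<lbrakk>x \<notin> N; \<bar>y - x\<bar> < d x\<rbrakk> \<Longrightarrow> \<bar>u y - u x - (y - x) * v x\<bar> \<le> e' * \<bar>y - x\<bar>"
      by metis
    show "\<exists>\<gamma>. gauge \<gamma> \<and> (\<forall>D. D tagged_division_of {a..b} \<and> \<gamma> fine D \<longrightarrow>
        norm ((\<Sum>(x, K)\<in>D. measure lborel K *\<^sub>R v x) - (u b - u a)) < e)"
    proof (rule exI[of _ "\<lambda>x. ball x (d x)"], intro conjI allI impI)
      show "gauge (\<lambda>x. ball x (d x))" using d(1) gauge_ball_dependent by blast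
      fix p assume pf: "p tagged_division_of {a..b} \<and> (\<lambda>x. ball x (d x)) fine p"
      note p = conjunct1[OF pf] and fine = conjunct2[OF pf]
      have K_cases: "\<exists>s t. s \<le> t \<and> K = {s..t} \<and> x \<in> {s..t} \<and> {s..t} \<subseteq> ball x (d x) \<and> {s..t} \<subseteq> {a..b}"
        if xK: "(x, K) \<in> p" for x K
      proof -
        obtain s t where K: "K = cbox s t" using tagged_division_ofD(4)[OF p xK] by blast
        have "x \<in> K" using tagged_division_ofD(2)[OF p xK] .
        moreover have "K \<subseteq> {a..b}" using tagged_division_ofD(3)[OF p xK] .
        moreover have "K \<subseteq> ball x (d x)" using fineD[OF fine xK] .
        ultimately show ?thesis using K by (intro exI[of _ s] exI[of _ t]) auto
      qed
      define q where "q = {(x, K) \<in> p. x \<in> N}"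
      have fin: "finite p" using p by blast
      have qp: "q \<subseteq> p" by (auto simp: q_def)
      let ?g = "\<lambda>(x, K). measure lborel K * v x - (u (Sup K) - u (Inf K))"
      have "(\<Sum>(x, K)\<in>p. measure lborel K *\<^sub>R v x) - (u b - u a) = (\<Sum>z\<in>p. ?g z)"
        unfolding additive_tagged_division_1[OF ab p, of u, symmetric]
        by (simp add: case_prod_unfold sum_subtractf)
      also have "\<dots> = (\<Sum>z\<in>p - q. ?g z) + (\<Sum>z\<in>q. ?g z)"
        by (rule sum.subset_diff[OF qp fin])
      finally have eq: "(\<Sum>(x, K)\<in>p. measure lborel K *\<^sub>R v x) - (u b - u a)
        = (\<Sum>z\<in>p - q. ?g z) + (\<Sum>z\<in>q. ?g z)" .
      \<comment> \<open>The tag lies in its interval, so \<open>(x - s) + (t - x)\<close> is exactly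
        the length: the linear errors at both endpoints add up to
        \<open>e' * (t - s)\<close>.\<close>
      have "\<bar>\<Sum>z\<in>p - q. ?g z\<bar> \<le> (\<Sum>(x, K)\<in>p - q. e' * (Sup K - Inf K))"
      proof (rule order_trans[OF sum_abs sum_mono])
        fix z assume z: "z \<in> p - q"
        obtain x K where zx: "z = (x, K)" by (cases z)
        then have xK: "(x, K) \<in> p" "x \<notin> N" using z by (auto simp: q_def)
        obtain s t where st: "s \<le> t" "K = {s..t}" "x \<in> {s..t}" "{s..t} \<subseteq> ball x (d x)"
          using K_cases[OF xK(1)] by blast
        have "s \<in> {s..t}" "t \<in> {s..t}" using st(1) by auto
        then have "s \<in> ball x (d x)" "t \<in> ball x (d x)" using st(4) by blast+
        then have "\<bar>s - x\<bar> < d x" "\<bar>t - x\<bar> < d x" by (auto simp: dist_real_def)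
        then have "\<bar>u s - u x - (s - x) * v x\<bar> \<le> e' * \<bar>s - x\<bar>" "\<bar>u t - u x - (t - x) * v x\<bar> \<le> e' * \<bar>t - x\<bar>"
          using d(3)[OF xK(2)] by blast+
        moreover have "\<bar>s - x\<bar> = x - s" "\<bar>t - x\<bar> = t - x" using st by auto
        ultimately have "\<bar>(t - s) * v x - (u t - u s)\<bar> \<le> e' * (x - s) + e' * (t - x)"
          by (simp add: algebra_simps)
        also have "\<dots> = e' * (t - s)" by (simp add: algebra_simps)
        finally show "\<bar>?g z\<bar> \<le> (case z of (x, K) \<Rightarrow> e' * (Sup K - Inf K))"
          using st(1) by (simp add: zx st(2))
      qed
      also have "\<dots> \<le> (\<Sum>(x, K)\<in>p. e' * (Sup K - Inf K))"
      proof (rule sum_mono2[OF fin Diff_subset])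
        fix z assume z: "z \<in> p - (p - q)"
        obtain x K where zx: "z = (x, K)" by (cases z)
        then obtain s t where "s \<le> t" "K = {s..t}" using K_cases[of x K] z by blast
        then show "0 \<le> (case z of (x, K) \<Rightarrow> e' * (Sup K - Inf K))"
          using e'(1) by (simp add: zx)
      qed
      also have "\<dots> = e' * (b - a)"
        using additive_tagged_division_1[OF ab p, of "\<lambda>x. x"]
        by (simp add: case_prod_unfold flip: sum_distrib_left)
      finally have 1: "\<bar>\<Sum>z\<in>p - q. ?g z\<bar> < e / 2" using e'(2) by simp
      have q: "q tagged_division_of \<Union>(snd ` q)"
        by (rule tagged_partial_division_of_Union_self,
            rule tagged_partial_division_subset[OF conjunct1[OF p[unfolded tagged_division_of_def]] qp])
      note qdiv = division_of_tagged_division[OF q]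
      \<comment> \<open>\<open>Sup\<close> and \<open>Inf\<close> of the empty set are unspecified,
        whereas passing from tagged pairs to intervals requires the value 0 on every degenerate
        interval, the empty one included.\<close>
      let ?d = "\<lambda>K. if K = {} then 0 else \<bar>u (Sup K) - u (Inf K)\<bar>"
      have "\<bar>\<Sum>z\<in>q. ?g z\<bar> \<le> (\<Sum>(x, K)\<in>q. ?d K)"
      proof (rule order_trans[OF sum_abs sum_mono])
        fix z assume z: "z \<in> q"
        obtain x K where zx: "z = (x, K)" by (cases z)
        then have "x \<in> N" "K \<noteq> {}" using z tagged_division_ofD(2)[OF q, of x K] by (auto simp: q_def)
        then show "\<bar>?g z\<bar> \<le> (case z of (x, K) \<Rightarrow> ?d K)" by (simp add: zx v_def)
      qed
      also have "\<dots> = (\<Sum>K\<in>snd ` q. ?d K)"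
      proof (rule sum.over_tagged_division_lemma[OF q])
        fix s t :: real assume "box s t = {}"
        then have "t \<le> s" by simp
        then show "?d (cbox s t) = 0"
          by (cases "t = s") auto
      qed
      also have "\<dots> = (\<Sum>K\<in>snd ` q. \<bar>u (Sup K) - u (Inf K)\<bar>)"
        by (rule sum.cong) (use division_ofD(3)[OF qdiv] in auto)
      also have "\<dots> < e / 2"
      proof (rule \<delta>(2)[rule_format], intro conjI qdiv)
        show "\<Union>(snd ` q) \<subseteq> {a..b}"
        proof (rule Union_least)
          fix K assume "K \<in> snd ` q"
          then obtain x where "(x, K) \<in> p" using qp by auto
          then show "K \<subseteq> {a..b}" by (rule tagged_division_ofD(3)[OF p])
        qed
        \<comment> \<open>Closed intervals of a division may share endpoints; their interiors are
          disjoint, have the same lengths and lie in \<open>T\<close>.\<close>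
        have int: "measure lborel K = measure lebesgue (interior K)" "interior K \<in> lmeasurable" "interior K \<subseteq> T"
          if K: "K \<in> snd ` q" for K
        proof -
          obtain x where x: "(x, K) \<in> p" "x \<in> N" using K by (auto simp: q_def)
          then obtain s t where "s \<le> t" "K = {s..t}" "{s..t} \<subseteq> ball x (d x)" using K_cases by blast
          then show "measure lborel K = measure lebesgue (interior K)" "interior K \<in> lmeasurable" "interior K \<subseteq> T"
            using d(2)[OF x(2)] interior_subset[of K] by auto
        qed
        have "(\<Sum>K\<in>snd ` q. measure lborel K) = (\<Sum>K\<in>snd ` q. measure lebesgue (interior K))"
          by (rule sum.cong) (auto simp: int)
        also have "\<dots> = measure lebesgue (\<Union>K\<in>snd ` q. interior K)"
        proof (rule measure_finite_Union[symmetric])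
          show "finite (snd ` q)" by (rule division_ofD(1)[OF qdiv])
          show "disjoint_family_on interior (snd ` q)"
            unfolding disjoint_family_on_def using division_ofD(5)[OF qdiv] by blast
          show "interior ` (snd ` q) \<subseteq> sets lebesgue" using int(2) by blast
          show "emeasure lebesgue (interior K) \<noteq> \<infinity>" if "K \<in> snd ` q" for K
            using fmeasurableD2[OF int(2)[OF that]] by simp
        qed
        also have "\<dots> \<le> measure lebesgue T"
          by (intro measure_mono_fmeasurable T(3) UN_least sets.finite_UN fmeasurableD int(2,3)
              division_ofD(1)[OF qdiv])
        finally show "(\<Sum>K\<in>snd ` q. measure lborel K) < \<delta>" using T(4) by simp
      qed
      finally have 2: "\<bar>\<Sum>z\<in>q. ?g z\<bar> < e / 2" .
      show "norm ((\<Sum>(x, K)\<in>p. measure lborel K *\<^sub>R v x) - (u b - u a)) < e"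
        unfolding eq real_norm_def using 1 2 by linarith
    qed
  qed
  then show ?thesis
    by (rule has_integral_spike[OF N, rotated]) (simp add: v_def)
qed

text \<open>\<open>deriv u\<close> is unspecified on a null set and so need not be Borel. The limit
  along \<open>1 / (n + 1)\<close> is a Borel function defined everywhere, and it agrees with the
  derivative wherever that exists.\<close>

lemma locally_abs_continuous_deriv_AE:
  assumes u: "locally_abs_continuous u"
  obtains g where "g \<in> borel_measurable borel" "AE x in lborel. DERIV u x :> g x"
proof
  define g where "g x = lim (\<lambda>n. (u (x + inverse (Suc n)) - u x) / inverse (Suc n))" for x
  have [measurable]: "u \<in> borel_measurable borel"
    using locally_abs_continuous_imp_isCont[OF u]
    by (intro borel_measurable_continuous_onI continuous_at_imp_continuous_on) auto
  show "g \<in> borel_measurable borel" unfolding g_def by measurable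
  have "negligible {x. \<not> u differentiable (at x)}" by (rule negligible_not_differentiable[OF u])
  then have "AE x in lebesgue. x \<notin> {x. \<not> u differentiable (at x)}"
    unfolding negligible_iff_null_sets by (rule AE_not_in)
  then have "AE x in lborel. x \<notin> {x. \<not> u differentiable (at x)}"
    unfolding AE_completion_iff .
  then show "AE x in lborel. DERIV u x :> g x"
  proof (rule AE_mp[OF _ AE_I2], intro impI)
    fix x assume "x \<notin> {x. \<not> u differentiable (at x)}"
    then obtain D where D: "DERIV u x :> D" by (auto simp: real_differentiable_def)
    have "filterlim (\<lambda>n. inverse (real (Suc n))) (at 0) sequentially"
      unfolding filterlim_at using LIMSEQ_inverse_real_of_nat by simp
    with D have "(\<lambda>n. (u (x + inverse (Suc n)) - u x) / inverse (Suc n)) \<longlonglongrightarrow> D"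
      unfolding DERIV_def by (rule filterlim_compose)
    then have "g x = D" unfolding g_def by (rule limI)
    with D show "DERIV u x :> g x" by simp
  qed
qed

text \<open>Nonnegative integrals spare any integrability assumption: an infinite right-hand side is
  trivial, and a finite one makes \<open>g\<close> Lebesgue integrable on the interval, where its
  integral equals the gauge integral.\<close>

lemma increment_le_nn_integral_deriv:
  assumes u: "locally_abs_continuous u" and g: "g \<in> borel_measurable borel"
    and ug: "AE x in lborel. DERIV u x :> g x" and ab: "a \<le> b"
  shows "ennreal \<bar>u b - u a\<bar> \<le> (\<integral>\<^sup>+x. ennreal \<bar>g x\<bar> * indicator {a..b} x \<partial>lborel)"
proof (cases "(\<integral>\<^sup>+x. ennreal \<bar>g x\<bar> * indicator {a..b} x \<partial>lborel) = \<infinity>")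
  case False
  note [measurable] = g
  have gi: "set_integrable lborel {a..b} g"
    unfolding set_integrable_def
  proof (rule integrableI_bounded)
    have "(\<integral>\<^sup>+x. ennreal (norm (indicator {a..b} x *\<^sub>R g x)) \<partial>lborel)
      = (\<integral>\<^sup>+x. ennreal \<bar>g x\<bar> * indicator {a..b} x \<partial>lborel)"
      by (intro nn_integral_cong) (auto simp: indicator_def)
    then show "(\<integral>\<^sup>+x. ennreal (norm (indicator {a..b} x *\<^sub>R g x)) \<partial>lborel) < \<infinity>"
      using False by (simp add: less_top)
  qed simp
  have "AE x in lebesgue. DERIV u x :> g x" using ug by (rule AE_completion)
  then obtain N where N: "N \<in> null_sets lebesgue" "{x. \<not> DERIV u x :> g x} \<subseteq> N"
    unfolding eventually_ae_filter by auto
  have "(g has_integral (u b - u a)) {a..b}"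
  proof (rule has_integral_spike[OF _ _ deriv_has_integral[OF u ab]])
    show "negligible N" using N(1) by (simp add: negligible_iff_null_sets)
    show "g x = deriv u x" if "x \<in> {a..b} - N" for x
    proof -
      have "DERIV u x :> g x" using N(2) that by blast
      then show ?thesis by (simp add: DERIV_imp_deriv)
    qed
  qed
  then have "u b - u a = (LINT x:{a..b}|lborel. g x)"
    by (simp add: set_borel_integral_eq_integral(2)[OF gi] integral_unique)
  then have "ennreal \<bar>u b - u a\<bar> \<le> (\<integral>\<^sup>+x. ennreal (norm (indicator {a..b} x *\<^sub>R g x)) \<partial>lborel)"
    using integral_norm_bound_ennreal[OF gi[unfolded set_integrable_def]]
    by (simp add: set_lebesgue_integral_def)
  also have "\<dots> = (\<integral>\<^sup>+x. ennreal \<bar>g x\<bar> * indicator {a..b} x \<partial>lborel)"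
    by (intro nn_integral_cong) (auto simp: indicator_def)
  finally show ?thesis .
qed simp



section \<open>The Cheeger inequality on the line\<close>

locale density_distribution = real_distribution M for M +
  fixes f :: "real \<Rightarrow> ennreal"
  assumes f_measurable [measurable]: "f \<in> borel_measurable borel"
    and M_density: "M = density lborel f"
begin

section \<open>Regularity of the distribution function\<close>

lemma AE_lborel_imp_AE:
  assumes "AE x in lborel. P x"
  shows "AE x in M. P x"
  unfolding M_density using assms by (subst AE_density) (auto simp: f_measurable)

lemma measure_singleton [simp]: "measure M {x} = 0"
proof -
  have "AE y in M. y \<notin> {x}"
    by (intro AE_lborel_imp_AE AE_not_in) (simp add: finite_imp_null_set_lborel)
  then show ?thesis by (simp add: prob_eq_0)
qed

lemma isCont_cdf_density: "isCont (cdf M) x"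
  by (simp add: isCont_cdf)

lemma cdf_diff_Ioo: "s \<le> t \<Longrightarrow> cdf M t - cdf M s = measure M {s<..<t}"
proof (cases "s = t")
  case False
  assume "s \<le> t"
  with False have st: "s < t" by simp
  then have "{s<..t} = {s<..<t} \<union> {t}" by auto
  then have "measure M {s<..t} = measure M {s<..<t} + measure M {t}"
    by (simp only:) (rule finite_measure_Union, auto)
  then show ?thesis using cdf_diff_eq[OF st] by simp
qed simp

lemma measure_atLeast: "measure M {x..} = 1 - cdf M x"
proof -
  have "measure M {..<x} = cdf M x"
    using isCont_cdf[of x] cdf_at_left[of x] isCont_cdf_density[of x]
    by (metis continuous_at_split continuous_within tendsto_unique trivial_limit_at_left_real)
  then have "measure M (space M - {..<x}) = 1 - cdf M x"
    by (subst prob_compl) auto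
  moreover have "space M - {..<x} = {x..}" by auto
  ultimately show ?thesis by simp
qed

text \<open>Truncating the density at a height \<open>n\<close> costs at most \<open>e / 2\<close>,
  and the bounded part has mass at most \<open>n\<close> times the length of \<open>A\<close>.
  Finiteness of \<open>emeasure lborel A\<close> is demanded because \<open>measure\<close> assigns
  0 to sets of infinite length.\<close>

lemma measure_small:
  assumes e: "e > 0"
  obtains d where "d > 0" "\<forall>A\<in>sets borel. measure lborel A < d \<longrightarrow> emeasure lborel A \<noteq> \<infinity> \<longrightarrow> measure M A < e"
proof -
  define g where "g n x = min (f x) (of_nat n)" for n :: nat and x
  have [measurable]: "g n \<in> borel_measurable borel" for n
    unfolding g_def by measurable
  have "incseq g" unfolding g_def
    by (intro incseq_SucI le_funI min.mono order_refl) simp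
  moreover have "g n \<in> borel_measurable lborel" for n by simp
  ultimately have "(\<integral>\<^sup>+x. (SUP n. g n x) \<partial>lborel) = (SUP n. \<integral>\<^sup>+x. g n x \<partial>lborel)"
    by (rule nn_integral_monotone_convergence_SUP)
  moreover have "(SUP n. g n x) = f x" for x
  proof -
    have "(SUP n. g n x) = min (f x) (SUP n. of_nat n)"
      unfolding g_def by (simp add: inf_min[symmetric] inf_SUP)
    then show ?thesis by (simp add: ennreal_SUP_of_nat_eq_top)
  qed
  moreover have "(\<integral>\<^sup>+x. f x \<partial>lborel) = 1"
  proof -
    have "emeasure M UNIV = 1" using emeasure_space_1 by simp
    then show ?thesis by (simp add: M_density emeasure_density)
  qed
  ultimately have sup: "(SUP n. \<integral>\<^sup>+x. g n x \<partial>lborel) = 1" and f1: "(\<integral>\<^sup>+x. f x \<partial>lborel) = 1" by simp_all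
  have "ennreal (1 - e / 2) < 1" using e by (simp add: ennreal_less_one_iff)
  then obtain n where n: "ennreal (1 - e / 2) < (\<integral>\<^sup>+x. g n x \<partial>lborel)"
    unfolding sup[symmetric] less_SUP_iff by blast
  have gf: "g n x \<le> f x" for x by (simp add: g_def)
  have "(\<integral>\<^sup>+x. g n x \<partial>lborel) \<le> 1" unfolding f1[symmetric] by (intro nn_integral_mono gf)
  then have gfin: "(\<integral>\<^sup>+x. g n x \<partial>lborel) \<noteq> \<infinity>" by (auto simp: top_unique)
  have diff: "(\<integral>\<^sup>+x. f x - g n x \<partial>lborel) \<le> ennreal (e / 2)"
  proof -
    have "(\<integral>\<^sup>+x. f x - g n x \<partial>lborel) = 1 - (\<integral>\<^sup>+x. g n x \<partial>lborel)"
      unfolding f1[symmetric] by (intro nn_integral_diff gfin) (auto simp: gf)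
    also have "\<dots> \<le> 1 - ennreal (1 - e / 2)" using n by (intro ennreal_minus_mono) auto
    also have "\<dots> \<le> ennreal (e / 2)"
      by (simp add: ennreal_minus_if flip: ennreal_1)
    finally show ?thesis .
  qed
  \<comment> \<open>This length makes the bounded part contribute less than \<open>e / 2\<close>;
    the added 1 avoids a division by zero.\<close>
  show thesis
  proof (rule that[of "e / (2 * (1 + real n))"], safe)
    show "e / (2 * (1 + real n)) > 0" using e by simp
    fix A :: "real set" assume A: "A \<in> sets borel" "measure lborel A < e / (2 * (1 + real n))" "emeasure lborel A \<noteq> \<infinity>"
    note [measurable] = A(1)
    have "emeasure M A = (\<integral>\<^sup>+x. f x * indicator A x \<partial>lborel)"
      using A(1) by (simp add: M_density emeasure_density)
    also have "\<dots> \<le> (\<integral>\<^sup>+x. of_nat n * indicator A x + (f x - g n x) \<partial>lborel)"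
    proof (intro nn_integral_mono)
      fix x
      have "f x = g n x + (f x - g n x)" using gf[of x] by (simp add: add_diff_inverse_ennreal)
      also have "\<dots> \<le> of_nat n + (f x - g n x)" by (intro add_right_mono) (simp add: g_def)
      finally show "f x * indicator A x \<le> of_nat n * indicator A x + (f x - g n x)"
        by (auto simp: indicator_def)
    qed
    also have "\<dots> = of_nat n * emeasure lborel A + (\<integral>\<^sup>+x. f x - g n x \<partial>lborel)"
      using A(1) by (subst nn_integral_add) (auto simp: nn_integral_cmult_indicator)
    also have "\<dots> \<le> of_nat n * emeasure lborel A + ennreal (e / 2)"
      by (intro add_left_mono diff)
    also have "emeasure lborel A = ennreal (measure lborel A)"
      using A(3) by (simp add: emeasure_eq_ennreal_measure)
    also have "of_nat n * ennreal (measure lborel A) + ennreal (e / 2) = ennreal (real n * measure lborel A + e / 2)"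
      using e by (simp add: ennreal_mult ennreal_of_nat_eq_real_of_nat)
    finally have "ennreal (measure M A) \<le> ennreal (real n * measure lborel A + e / 2)"
      by (simp only: emeasure_eq_measure)
    then have "measure M A \<le> real n * measure lborel A + e / 2"
      by (rule ennreal_le_iff[THEN iffD1, rotated]) (use e in simp)
    also have "real n * measure lborel A \<le> real n * (e / (2 * (1 + real n)))"
      using A(2) by (intro mult_left_mono) auto
    also have "\<dots> < e / 2" using e by (simp add: field_simps)
    finally show "measure M A < e" by simp
  qed
qed

text \<open>The increments over disjoint intervals are the mass of their union, so
  \<open>measure_small\<close> applies. Differentiability almost everywhere and the fundamental
  theorem thereby become available for \<open>F\<close>.\<close>

lemma locally_abs_continuous_cdf: "locally_abs_continuous (cdf M)"
  unfolding locally_abs_continuous_def abs_continuous_on_Icc_def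
proof (intro allI impI)
  fix a b e :: real assume "a \<le> b" "e > 0"
  obtain d where d: "d > 0" "\<forall>A\<in>sets borel. measure lborel A < d \<longrightarrow> emeasure lborel A \<noteq> \<infinity> \<longrightarrow> measure M A < e"
    by (rule measure_small[OF \<open>e > 0\<close>])
  show "\<exists>\<delta>>0. \<forall>(n::nat) s t.
        (\<forall>i<n. a \<le> s i \<and> s i \<le> t i \<and> t i \<le> b) \<and>
        disjoint_family_on (\<lambda>i. {s i<..<t i}) {..<n} \<and>
        (\<Sum>i<n. t i - s i) < \<delta> \<longrightarrow> (\<Sum>i<n. \<bar>cdf M (t i) - cdf M (s i)\<bar>) < e"
  proof (rule exI, rule conjI[OF d(1)], intro allI impI)
    fix n :: nat and s t :: "nat \<Rightarrow> real"
    assume *: "(\<forall>i<n. a \<le> s i \<and> s i \<le> t i \<and> t i \<le> b) \<and>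
        disjoint_family_on (\<lambda>i. {s i<..<t i}) {..<n} \<and> (\<Sum>i<n. t i - s i) < d"
    let ?A = "\<Union>i<n. {s i<..<t i}"
    have "measure lborel ?A = (\<Sum>i<n. measure lborel {s i<..<t i})"
      by (rule measure_finite_Union) (use * in auto)
    also have "\<dots> = (\<Sum>i<n. t i - s i)" using * by (intro sum.cong) auto
    finally have "measure lborel ?A < d" using * by simp
    moreover have "emeasure lborel ?A \<noteq> \<infinity>"
    proof -
      have "emeasure lborel ?A \<le> emeasure lborel {a..b}"
        using * by (intro emeasure_mono UN_least) fastforce+
      then show ?thesis using \<open>a \<le> b\<close> by (auto simp: top_unique)
    qed
    ultimately have "measure M ?A < e" using d(2)[rule_format, of ?A] by simp
    also have "measure M ?A = (\<Sum>i<n. measure M {s i<..<t i})"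
      by (rule measure_finite_Union) (use * in auto)
    also have "\<dots> = (\<Sum>i<n. \<bar>cdf M (t i) - cdf M (s i)\<bar>)"
    proof (intro sum.cong refl)
      fix i assume "i \<in> {..<n}"
      then have "s i \<le> t i" using * by auto
      then show "measure M {s i<..<t i} = \<bar>cdf M (t i) - cdf M (s i)\<bar>"
        using cdf_nondecreasing by (simp flip: cdf_diff_Ioo add: abs_of_nonneg)
    qed
    finally show "(\<Sum>i<n. \<bar>cdf M (t i) - cdf M (s i)\<bar>) < e" .
  qed
qed

text \<open>The fundamental theorem for \<open>F\<close> gives equality on bounded half-open
  intervals; exhausting half-lines by these determines the measure. Integrals of \<open>F'\<close>
  against Lebesgue measure can then be read as expectations.\<close>

lemma density_deriv_cdf:
  assumes g: "g \<in> borel_measurable borel" and Fg: "AE x in lborel. DERIV (cdf M) x :> g x"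
  shows "M = density lborel (\<lambda>x. ennreal (g x))"
proof (rule measure_eqI_lessThan)
  note [measurable] = g
  have nonneg: "g x \<ge> 0" if "DERIV (cdf M) x :> g x" for x
  proof -
    have "mono_on UNIV (cdf M)" by (intro mono_onI cdf_nondecreasing)
    from mono_on_imp_deriv_nonneg[OF this that] show ?thesis by simp
  qed
  have Icc: "emeasure M {a<..b} = emeasure (density lborel (\<lambda>x. ennreal (g x))) {a<..b}" if ab: "a \<le> b" for a b
  proof -
    have "AE x in lebesgue. DERIV (cdf M) x :> g x" using Fg by (rule AE_completion)
    then obtain N where N: "N \<in> null_sets lebesgue" "{x. \<not> DERIV (cdf M) x :> g x} \<subseteq> N"
      unfolding eventually_ae_filter by auto
    \<comment> \<open>\<open>g\<close> is known to be nonnegative only where it is the derivative of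
      the monotone \<open>F\<close>; the absolute value gives an integrand that is nonnegative
      everywhere.\<close>
    have "((\<lambda>x. \<bar>g x\<bar>) has_integral (cdf M b - cdf M a)) {a..b}"
    proof (rule has_integral_spike[OF _ _ deriv_has_integral[OF locally_abs_continuous_cdf ab]])
      show "negligible N" using N(1) by (simp add: negligible_iff_null_sets)
      show "\<bar>g x\<bar> = deriv (cdf M) x" if x: "x \<in> {a..b} - N" for x
      proof -
        have "DERIV (cdf M) x :> g x" using x N(2) by blast
        then show ?thesis using nonneg DERIV_imp_deriv by force
      qed
    qed
    from nn_integral_has_integral_lebesgue[OF _ this]
    have "ennreal (cdf M b - cdf M a) = (\<integral>\<^sup>+x. ennreal (indicator {a..b} x * \<bar>g x\<bar>) \<partial>lborel)" by simp
    also have "\<dots> = (\<integral>\<^sup>+x. ennreal (g x) * indicator {a<..b} x \<partial>lborel)"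
    proof (rule nn_integral_cong_AE)
      have "AE x in lborel. x \<noteq> a" by (rule AE_lborel_singleton)
      with Fg show "AE x in lborel. ennreal (indicator {a..b} x * \<bar>g x\<bar>) = ennreal (g x) * indicator {a<..b} x"
        by eventually_elim (auto simp: indicator_def dest: nonneg)
    qed
    finally show ?thesis using emeasure_Ioc[OF ab] by (simp add: emeasure_density)
  qed
  show "emeasure M {x<..} = emeasure (density lborel (\<lambda>x. ennreal (g x))) {x<..}" for x
  proof -
    have un: "(\<Union>n. {x<..x + real n}) = {x<..}"
    proof (intro set_eqI iffI)
      fix y assume "y \<in> {x<..}"
      moreover obtain n where "y - x \<le> real n" using real_arch_simple by blast
      ultimately have "y \<in> {x<..x + real n}" by auto
      then show "y \<in> (\<Union>n. {x<..x + real n})" by blast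
    qed auto
    have inc: "incseq (\<lambda>n. {x<..x + real n})" by (auto simp: incseq_def)
    have ran: "range (\<lambda>n. {x<..x + real n}) \<subseteq> sets borel" by auto
    have "(SUP n. emeasure M {x<..x + real n}) = emeasure M {x<..}"
      using SUP_emeasure_incseq[OF _ inc, of M] ran un by simp
    moreover have "(SUP n. emeasure (density lborel (\<lambda>x. ennreal (g x))) {x<..x + real n}) = emeasure (density lborel (\<lambda>x. ennreal (g x))) {x<..}"
      using SUP_emeasure_incseq[OF _ inc, of "density lborel (\<lambda>x. ennreal (g x))"] ran un by simp
    ultimately show ?thesis using Icc[of x "x + real n" for n] by simp
  qed
  show "emeasure M {x<..} < \<infinity>" for x by (simp add: less_top[symmetric])
qed (simp_all)

section \<open>The isoperimetric inequality on half-lines\<close>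

lemma admissible_le_deriv_cdf:
  assumes "0 \<le> c" and adm: "\<forall>A\<in>sets borel. ennreal (c * min (measure M A) (1 - measure M A)) \<le> boundary_measure M A"
    and D: "DERIV (cdf M) x :> D"
  shows "c * min (cdf M x) (1 - cdf M x) \<le> D"
proof -
  have "mono_on UNIV (cdf M)" by (intro mono_onI cdf_nondecreasing)
  from mono_on_imp_deriv_nonneg[OF this D] have "D \<ge> 0" by simp
  \<comment> \<open>Enlarging \<open>{..x}\<close> gives \<open>{..<x + h}\<close>, so the boundary
    quotient is the right difference quotient of \<open>F\<close>, points having no mass.\<close>
  have "boundary_measure M {..x} = Liminf (at_right 0) (\<lambda>h. ennreal ((cdf M (x + h) - cdf M x) / h))"
    unfolding boundary_measure_def
  proof (rule Liminf_eq)
    show "\<forall>\<^sub>F h in at_right 0. ennreal ((measure M (enlargement h {..x}) - measure M {..x}) / h)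
      = ennreal ((cdf M (x + h) - cdf M x) / h)"
      using eventually_at_right_less[of 0]
    proof eventually_elim
      fix h :: real assume h: "0 < h"
      have "enlargement h {..x} = {..<x + h}"
      proof (intro set_eqI iffI)
        fix y assume "y \<in> {..<x + h}"
        then show "y \<in> enlargement h {..x}"
          using h by (auto simp: enlargement_def intro!: bexI[of _ "min x y"])
      qed (auto simp: enlargement_def)
      also have "\<dots> = {..x} \<union> {x<..<x + h}" using h by auto
      also have "measure M \<dots> = measure M {..x} + measure M {x<..<x + h}"
        by (intro finite_measure_Union) auto
      also have "\<dots> = cdf M (x + h)"
        using cdf_diff_Ioo[of x "x + h"] h by (simp add: cdf_def)
      finally show "ennreal ((measure M (enlargement h {..x}) - measure M {..x}) / h)
        = ennreal ((cdf M (x + h) - cdf M x) / h)" by (simp add: cdf_def)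
    qed
  qed
  also have "\<dots> = ennreal D"
  proof (rule lim_imp_Liminf)
    have "((\<lambda>h. (cdf M (x + h) - cdf M x) / h) \<longlongrightarrow> D) (at_right 0)"
      using D unfolding DERIV_def by (rule filterlim_mono) (auto simp: at_within_le_at)
    then show "((\<lambda>h. ennreal ((cdf M (x + h) - cdf M x) / h)) \<longlongrightarrow> ennreal D) (at_right 0)"
      by (rule tendsto_ennrealI)
  qed simp
  finally have "ennreal (c * min (cdf M x) (1 - cdf M x)) \<le> ennreal D"
    using adm[rule_format, of "{..x}"] by (simp add: cdf_def)
  then show ?thesis using \<open>D \<ge> 0\<close> by simp
qed

lemma ex_median: "\<exists>x. cdf M x = 1 / 2"
proof -
  have "eventually (\<lambda>x. cdf M x > 1 / 2) at_top"
    using cdf_lim_at_top_prob by (rule order_tendstoD) simp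
  then obtain b where b: "\<And>x. x \<ge> b \<Longrightarrow> cdf M x > 1 / 2" by (auto simp: eventually_at_top_linorder)
  have "eventually (\<lambda>x. cdf M x < 1 / 2) at_bot"
    using cdf_lim_at_bot by (rule order_tendstoD) simp
  then obtain a where a: "\<And>x. x \<le> a \<Longrightarrow> cdf M x < 1 / 2" by (auto simp: eventually_at_bot_linorder)
  have "\<exists>x. min a b \<le> x \<and> x \<le> max a b \<and> cdf M x = 1 / 2"
    using a[of "min a b"] b[of "max a b"] isCont_cdf_density by (intro IVT) auto
  then show ?thesis by blast
qed

text \<open>The constant is a supremum in \<open>ennreal\<close>, so its finiteness needs proof: a
  single point where \<open>F\<close> is differentiable and \<open>m\<close> is positive bounds all
  admissible constants at once. The supremum then inherits the pointwise bound.\<close>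

lemma cheeger_const_le_deriv_cdf:
  assumes pos: "cheeger_const M > 0"
  obtains c where "c > 0" "cheeger_const M = ennreal c"
    "\<forall>x D. DERIV (cdf M) x :> D \<longrightarrow> c * min (cdf M x) (1 - cdf M x) \<le> D"
proof -
  let ?m = "\<lambda>x. min (cdf M x) (1 - cdf M x)"
  let ?S = "{ennreal c | c. 0 \<le> c \<and>
       (\<forall>A\<in>sets borel. ennreal (c * min (measure M A) (1 - measure M A)) \<le> boundary_measure M A)}"
  have le: "cheeger_const M \<le> ennreal (D / ?m x)" if D: "DERIV (cdf M) x :> D" and m: "?m x > 0" for x D
    unfolding cheeger_const_def
  proof (rule Sup_least)
    fix z assume "z \<in> ?S"
    then obtain c where c: "z = ennreal c" "0 \<le> c"
      "\<forall>A\<in>sets borel. ennreal (c * min (measure M A) (1 - measure M A)) \<le> boundary_measure M A"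
      by blast
    have "c \<le> D / ?m x" using admissible_le_deriv_cdf[OF c(2,3) D] m by (simp add: pos_le_divide_eq)
    then show "z \<le> ennreal (D / ?m x)" unfolding c(1) by (rule ennreal_leI)
  qed
  have m_nonneg: "?m x \<ge> 0" for x using cdf_nonneg cdf_bounded_prob by simp
  \<comment> \<open>By continuity \<open>m\<close> is positive on a ball around a median, and a ball
    is too large to consist of points of non-differentiability.\<close>
  obtain x D where x: "DERIV (cdf M) x :> D" "?m x > 0"
  proof -
    obtain x0 where x0: "cdf M x0 = 1 / 2" using ex_median by blast
    have "isCont ?m x0" using isCont_cdf_density by (intro continuous_intros)
    then have "eventually (\<lambda>x. ?m x > 0) (nhds x0)"
      using order_tendstoD(1)[of ?m "?m x0" "at x0" 0] x0
      by (simp add: continuous_within eventually_nhds_conv_at)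
    then obtain e where e: "e > 0" "\<And>x. dist x x0 < e \<Longrightarrow> ?m x > 0"
      by (auto simp: eventually_nhds_metric)
    have "\<not> ball x0 e \<subseteq> {x. \<not> cdf M differentiable (at x)}"
      using negligible_subset[OF negligible_not_differentiable[OF locally_abs_continuous_cdf]]
        open_not_negligible[OF open_ball, of x0 e] e(1) by auto
    then obtain x where "x \<in> ball x0 e" "cdf M differentiable (at x)" by blast
    then show thesis using e(2)[of x] that by (auto simp: real_differentiable_def dist_commute)
  qed
  define c where "c = enn2real (cheeger_const M)"
  have c: "cheeger_const M = ennreal c"
    using le[OF x] unfolding c_def by (subst ennreal_enn2real) (auto simp: le_less_trans)
  show thesis
  proof (rule that[OF _ c])
    show "c > 0" using pos c by (simp add: ennreal_less_zero_iff)
    show "\<forall>x D. DERIV (cdf M) x :> D \<longrightarrow> c * ?m x \<le> D"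
    proof (intro allI impI)
      fix x D assume D: "DERIV (cdf M) x :> D"
      have "mono_on UNIV (cdf M)" by (intro mono_onI cdf_nondecreasing)
      from mono_on_imp_deriv_nonneg[OF this D] have "D \<ge> 0" by simp
      show "c * ?m x \<le> D"
      proof (cases "?m x > 0")
        case True
        then have "c \<le> D / ?m x" using le[OF D True] \<open>D \<ge> 0\<close> unfolding c by (simp add: ennreal_le_iff)
        then show ?thesis using True by (simp add: pos_le_divide_eq)
      next
        case False
        then have "?m x = 0" using m_nonneg[of x] by linarith
        then show ?thesis using \<open>D \<ge> 0\<close> by simp
      qed
    qed
  qed
qed

text \<open>After the exchange of integrals the kernel at \<open>y\<close> is the mass of the points
  \<open>x\<close> separated from the median by \<open>y\<close>: a half-line pointing away from
  \<open>x0\<close>, hence the lighter of the two at \<open>y\<close>. This is exactly the quantity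
  that \<open>F' / c\<close> dominates.\<close>

lemma L1_median_Cheeger:
  assumes c: "c > 0" "\<forall>x D. DERIV (cdf M) x :> D \<longrightarrow> c * min (cdf M x) (1 - cdf M x) \<le> D"
    and w: "locally_abs_continuous w" and x0: "cdf M x0 = 1 / 2"
  shows "(\<integral>\<^sup>+x. ennreal \<bar>w x - w x0\<bar> \<partial>M) \<le> ennreal (1 / c) * (\<integral>\<^sup>+x. ennreal \<bar>deriv w x\<bar> \<partial>M)"
proof -
  obtain g where g[measurable]: "g \<in> borel_measurable borel" and wg: "AE x in lborel. DERIV w x :> g x"
    using locally_abs_continuous_deriv_AE[OF w] by blast
  obtain F' where F'[measurable]: "F' \<in> borel_measurable borel" and FF': "AE x in lborel. DERIV (cdf M) x :> F' x"
    using locally_abs_continuous_deriv_AE[OF locally_abs_continuous_cdf] by blast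
  let ?m = "\<lambda>x. min (cdf M x) (1 - cdf M x)"
  \<comment> \<open>Writing the condition as a set of pairs gives the joint measurability required
    by Fubini.\<close>
  let ?I = "\<lambda>x y. indicator {z. min (fst z) x0 \<le> snd z \<and> snd z \<le> max (fst z) x0} (x, y) :: ennreal"
  have "(\<integral>\<^sup>+x. ennreal \<bar>w x - w x0\<bar> \<partial>M) \<le> (\<integral>\<^sup>+x. (\<integral>\<^sup>+y. ennreal \<bar>g y\<bar> * ?I x y \<partial>lborel) \<partial>M)"
  proof (rule nn_integral_mono)
    fix x
    have "ennreal \<bar>w x - w x0\<bar> = ennreal \<bar>w (max x x0) - w (min x x0)\<bar>"
      by (cases "x \<le> x0") (auto simp: max_def min_def)
    also have "\<dots> \<le> (\<integral>\<^sup>+y. ennreal \<bar>g y\<bar> * indicator {min x x0..max x x0} y \<partial>lborel)"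
      by (rule increment_le_nn_integral_deriv[OF w g wg]) simp
    also have "\<dots> = (\<integral>\<^sup>+y. ennreal \<bar>g y\<bar> * ?I x y \<partial>lborel)"
      by (intro nn_integral_cong) (auto simp: indicator_def)
    finally show "ennreal \<bar>w x - w x0\<bar> \<le> (\<integral>\<^sup>+y. ennreal \<bar>g y\<bar> * ?I x y \<partial>lborel)" .
  qed
  also have "\<dots> = (\<integral>\<^sup>+y. (\<integral>\<^sup>+x. ennreal \<bar>g y\<bar> * ?I x y \<partial>M) \<partial>lborel)"
  proof -
    interpret P: pair_sigma_finite M lborel ..
    have "(\<lambda>(x, y). ennreal \<bar>g y\<bar> * ?I x y) \<in> borel_measurable (M \<Otimes>\<^sub>M lborel)" by measurable
    from P.Fubini'[OF this] show ?thesis by simp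
  qed
  also have "\<dots> \<le> (\<integral>\<^sup>+y. ennreal (1 / c) * (ennreal (F' y) * ennreal \<bar>g y\<bar>) \<partial>lborel)"
  proof (rule nn_integral_mono_AE)
    \<comment> \<open>At \<open>y = x0\<close> every \<open>x\<close> satisfies the betweenness
      condition and the kernel is 1 instead of \<open>1 / 2\<close>; this one point is
      discarded.\<close>
    have "AE y in lborel. y \<noteq> x0" by (rule AE_lborel_singleton)
    with FF' show "AE y in lborel. (\<integral>\<^sup>+x. ennreal \<bar>g y\<bar> * ?I x y \<partial>M) \<le> ennreal (1 / c) * (ennreal (F' y) * ennreal \<bar>g y\<bar>)"
    proof eventually_elim
      fix y assume D: "DERIV (cdf M) y :> F' y" and y: "y \<noteq> x0"
      let ?A = "{x. min x x0 \<le> y \<and> y \<le> max x x0}"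
      have A: "?A = (if y < x0 then {..y} else {y..})" using y by auto
      have "(\<integral>\<^sup>+x. ennreal \<bar>g y\<bar> * ?I x y \<partial>M) = (\<integral>\<^sup>+x. ennreal \<bar>g y\<bar> * indicator ?A x \<partial>M)"
        by (intro nn_integral_cong) (auto simp: indicator_def)
      also have "\<dots> = ennreal \<bar>g y\<bar> * emeasure M ?A"
        by (rule nn_integral_cmult_indicator) (simp add: A)
      also have "emeasure M ?A = ennreal (?m y)"
      proof (cases "y < x0")
        case True
        then have "cdf M y \<le> 1 / 2" using cdf_nondecreasing[of y x0] x0 by simp
        then show ?thesis using True unfolding A by (simp add: emeasure_eq_measure cdf_def)
      next
        case False
        then have "cdf M y \<ge> 1 / 2" using cdf_nondecreasing[of x0 y] x0 by simp
        then show ?thesis using False unfolding A by (simp add: emeasure_eq_measure measure_atLeast)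
      qed
      also have "ennreal \<bar>g y\<bar> * ennreal (?m y) \<le> ennreal \<bar>g y\<bar> * ennreal (1 / c * F' y)"
        using c(2)[rule_format, OF D] c(1) by (intro mult_left_mono ennreal_leI) (auto simp: field_simps)
      also have "\<dots> = ennreal (1 / c) * (ennreal (F' y) * ennreal \<bar>g y\<bar>)"
      proof -
        have "ennreal (1 / c * F' y) = ennreal (1 / c) * ennreal (F' y)"
          using c(1) by (intro ennreal_mult') simp
        then show ?thesis by (simp only: mult_ac)
      qed
      finally show "(\<integral>\<^sup>+x. ennreal \<bar>g y\<bar> * ?I x y \<partial>M) \<le> ennreal (1 / c) * (ennreal (F' y) * ennreal \<bar>g y\<bar>)" .
    qed
  qed
  also have "\<dots> = ennreal (1 / c) * (\<integral>\<^sup>+y. ennreal (F' y) * ennreal \<bar>g y\<bar> \<partial>lborel)"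
    by (rule nn_integral_cmult) simp
  also have "(\<integral>\<^sup>+y. ennreal (F' y) * ennreal \<bar>g y\<bar> \<partial>lborel) = (\<integral>\<^sup>+y. ennreal \<bar>g y\<bar> \<partial>M)"
    by (subst density_deriv_cdf[OF F' FF']) (simp add: nn_integral_density)
  also have "\<dots> = (\<integral>\<^sup>+y. ennreal \<bar>deriv w y\<bar> \<partial>M)"
  proof (rule nn_integral_cong_AE)
    show "AE y in M. ennreal \<bar>g y\<bar> = ennreal \<bar>deriv w y\<bar>"
      using AE_lborel_imp_AE[OF wg] by eventually_elim (simp add: DERIV_imp_deriv)
  qed
  finally show ?thesis .
qed

end

section \<open>Moments of order \<open>p\<close>\<close>

text \<open>The odd counterpart of \<open>\<bar>t\<bar> powr p\<close>: it has the same absolute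
  value but is differentiable at 0 even for \<open>p = 1\<close>, and for odd integers it is the
  ordinary power.\<close>

definition signed_powr :: "real \<Rightarrow> real \<Rightarrow> real" where
  "signed_powr p t = rsign t * \<bar>t\<bar> powr p"

lemma rsign_cases: "rsign x = (if x \<ge> 0 then 1 else - 1)"
  by (simp add: rsign_def)

lemma abs_signed_powr: "\<bar>signed_powr p t\<bar> = \<bar>t\<bar> powr p"
  by (simp add: signed_powr_def rsign_cases abs_mult)

lemma signed_powr_odd:
  assumes "odd n"
  shows "signed_powr (real n) t = t ^ n"
proof -
  have "\<bar>t\<bar> powr real n = \<bar>t\<bar> ^ n"
    using odd_pos[OF assms] by (cases "t = 0") (simp_all add: powr_realpow)
  then show ?thesis
    using assms by (simp add: signed_powr_def rsign_cases)
qed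

lemma nonneg_power_mult_self: "p \<ge> 1 \<Longrightarrow> nonneg_power \<bar>x\<bar> (p - 1) * \<bar>x\<bar> = \<bar>x\<bar> powr p" for x :: real
  by (cases "x = 0") (auto simp: nonneg_power_def powr_diff)

lemma nonneg_power_nonneg: "nonneg_power \<bar>x\<bar> a \<ge> 0"
  by (simp add: nonneg_power_def)

text \<open>Young's inequality with exponents \<open>p / (p - 1)\<close> and \<open>p\<close>,
  cleared of denominators. The first exponent breaks down at \<open>p = 1\<close>, where the
  convention for the zeroth power turns the claim into an equality.\<close>

lemma Young_power:
  assumes "p \<ge> 1"
  shows "p * nonneg_power \<bar>x\<bar> (p - 1) * \<bar>y\<bar> \<le> (p - 1) * \<bar>x\<bar> powr p + \<bar>y\<bar> powr p"
proof (cases "p = 1")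
  case False
  with assms have p: "p > 1" by simp
  have "\<bar>x\<bar> powr (p - 1) * \<bar>y\<bar> \<le> (\<bar>x\<bar> powr (p - 1)) powr (p / (p - 1)) / (p / (p - 1)) + \<bar>y\<bar> powr p / p"
    using p by (intro Youngs_inequality) (auto simp: field_simps)
  also have "(\<bar>x\<bar> powr (p - 1)) powr (p / (p - 1)) = \<bar>x\<bar> powr p"
    using p by (simp add: powr_powr)
  finally have "p * (\<bar>x\<bar> powr (p - 1) * \<bar>y\<bar>) \<le> p * (\<bar>x\<bar> powr p / (p / (p - 1)) + \<bar>y\<bar> powr p / p)"
    using p by (intro mult_left_mono) auto
  also have "\<dots> = (p - 1) * \<bar>x\<bar> powr p + \<bar>y\<bar> powr p" using p by (simp add: field_simps)
  finally show ?thesis using p by (simp add: nonneg_power_def mult.assoc)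
qed (simp add: nonneg_power_def)

text \<open>Convexity of \<open>\<bar>t\<bar> powr p\<close> as a supporting line at
  \<open>x\<close>, obtained from Young's inequality. At the corner of the case \<open>p = 1\<close>
  the value \<open>rsign 0 = 1\<close> selects one valid slope.\<close>

lemma powr_subgradient:
  assumes "p \<ge> 1"
  shows "\<bar>x\<bar> powr p + p * (rsign x * nonneg_power \<bar>x\<bar> (p - 1)) * (y - x) \<le> \<bar>y\<bar> powr p"
proof -
  have "p * (rsign x * nonneg_power \<bar>x\<bar> (p - 1)) * (y - x)
    = p * nonneg_power \<bar>x\<bar> (p - 1) * (rsign x * y) - p * (nonneg_power \<bar>x\<bar> (p - 1) * (rsign x * x))"
    by (simp add: algebra_simps)
  also have "rsign x * x = \<bar>x\<bar>" by (simp add: rsign_cases)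
  also have "nonneg_power \<bar>x\<bar> (p - 1) * \<bar>x\<bar> = \<bar>x\<bar> powr p" by (rule nonneg_power_mult_self[OF assms])
  also have "p * nonneg_power \<bar>x\<bar> (p - 1) * (rsign x * y) \<le> p * nonneg_power \<bar>x\<bar> (p - 1) * \<bar>y\<bar>"
    using assms nonneg_power_nonneg[of x] by (intro mult_left_mono) (auto simp: rsign_cases)
  also have "\<dots> \<le> (p - 1) * \<bar>x\<bar> powr p + \<bar>y\<bar> powr p" by (rule Young_power[OF assms])
  finally show ?thesis by (simp add: algebra_simps)
qed

lemma powr_sum_le:
  fixes x y :: real
  assumes "p \<ge> 1"
  shows "\<bar>x + y\<bar> powr p \<le> 2 powr p / 2 * (\<bar>x\<bar> powr p + \<bar>y\<bar> powr p)"
proof -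
  \<comment> \<open>Supporting lines at the midpoint: evaluated at \<open>x\<close> and
    \<open>y\<close>, their linear terms cancel.\<close>
  define m where "m = (x + y) / 2"
  let ?g = "p * (rsign m * nonneg_power \<bar>m\<bar> (p - 1))"
  have "\<bar>m\<bar> powr p + ?g * (x - m) \<le> \<bar>x\<bar> powr p" "\<bar>m\<bar> powr p + ?g * (y - m) \<le> \<bar>y\<bar> powr p"
    by (rule powr_subgradient[OF assms])+
  moreover have "?g * (x - m) + ?g * (y - m) = ?g * (x + y - 2 * m)" by (simp only: algebra_simps) 
  moreover have "x + y - 2 * m = 0" by (simp add: m_def)
  ultimately have "2 * \<bar>m\<bar> powr p \<le> \<bar>x\<bar> powr p + \<bar>y\<bar> powr p" by simp
  moreover have "\<bar>x + y\<bar> powr p = 2 powr p * \<bar>m\<bar> powr p"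
    by (simp add: m_def powr_divide)
  moreover have "2 powr p / 2 * (2 * \<bar>m\<bar> powr p) \<le> 2 powr p / 2 * (\<bar>x\<bar> powr p + \<bar>y\<bar> powr p)"
    by (intro mult_left_mono calculation) simp
  ultimately show ?thesis by simp
qed

lemma nonneg_power_le: "p \<ge> 1 \<Longrightarrow> nonneg_power \<bar>x\<bar> (p - 1) \<le> 1 + \<bar>x\<bar> powr p" for x :: real
proof (cases "\<bar>x\<bar> \<le> 1")
  case True
  assume "p \<ge> 1"
  then have "nonneg_power \<bar>x\<bar> (p - 1) \<le> 1" using True powr_mono2[of "p - 1" "\<bar>x\<bar>" 1]
    by (auto simp: nonneg_power_def)
  then show ?thesis using powr_ge_zero[of "\<bar>x\<bar>" p] by linarith
next
  case False
  assume "p \<ge> 1"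
  then have "nonneg_power \<bar>x\<bar> (p - 1) \<le> \<bar>x\<bar> powr p" using False powr_mono[of "p - 1" p "\<bar>x\<bar>"]
    by (auto simp: nonneg_power_def)
  then show ?thesis by simp
qed

text \<open>With the zeroth power equal to 1, one formula covers the identity map
  (\<open>p = 1\<close>) and the vanishing derivative at 0 for \<open>p > 1\<close>; the latter
  holds because the quotient at 0 is \<open>\<bar>h\<bar> powr (p - 1)\<close>.\<close>

lemma DERIV_signed_powr:
  assumes "p \<ge> 1"
  shows "DERIV (signed_powr p) t :> p * nonneg_power \<bar>t\<bar> (p - 1)"
proof (cases "p = 1")
  case True
  then have "signed_powr p = (\<lambda>t. t)" by (auto simp: signed_powr_def rsign_cases)
  then show ?thesis using True by (simp add: nonneg_power_def)
next
  case False
  with assms have p: "p > 1" by simp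
  consider "t > 0" | "t < 0" | "t = 0" by linarith
  then show ?thesis
  proof cases
    case 1
    have "DERIV (\<lambda>x. x powr p) t :> p * t powr (p - 1)"
      using has_real_derivative_powr[OF 1] .
    then have "DERIV (signed_powr p) t :> p * t powr (p - 1)"
      by (rule has_field_derivative_transform_within_open[where S="{0<..}"])
        (use 1 in \<open>auto simp: signed_powr_def rsign_cases\<close>)
    then show ?thesis using 1 p by (simp add: nonneg_power_def)
  next
    case 2
    have "DERIV (\<lambda>x. - ((- x) powr p)) t :> p * (- t) powr (p - 1)"
      using 2 by (auto intro!: derivative_eq_intros)
    then have "DERIV (signed_powr p) t :> p * (- t) powr (p - 1)"
      by (rule has_field_derivative_transform_within_open[where S="{..<0}"])
        (use 2 in \<open>auto simp: signed_powr_def rsign_cases\<close>)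
    then show ?thesis using 2 p by (simp add: nonneg_power_def)
  next
    case 3
    have "((\<lambda>h::real. \<bar>h\<bar> powr (p - 1)) \<longlongrightarrow> \<bar>0\<bar> powr (p - 1)) (at 0)"
      using p by (intro tendsto_powr2 tendsto_rabs tendsto_ident_at tendsto_const) (auto intro!: always_eventually)
    then have "((\<lambda>h. \<bar>h\<bar> powr (p - 1)) \<longlongrightarrow> 0) (at (0::real))" by simp
    then have "((\<lambda>h. signed_powr p h / h) \<longlongrightarrow> 0) (at 0)"
    proof (rule Lim_transform_eventually)
      show "\<forall>\<^sub>F h in at 0. \<bar>h\<bar> powr (p - 1) = signed_powr p h / h"
        using eventually_neq_at_within[of 0 0 UNIV]
        by eventually_elim (auto simp: signed_powr_def rsign_cases powr_diff)
    qed
    then show ?thesis using 3 p by (simp add: DERIV_def signed_powr_def nonneg_power_def)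
  qed
qed

lemma locally_abs_continuous_signed_powr:
  assumes "p \<ge> 1" "locally_abs_continuous u"
  shows "locally_abs_continuous (\<lambda>x. signed_powr p (u x))"
proof (rule locally_abs_continuous_compose[OF assms(2)])
  fix R :: real
  \<comment> \<open>A crude bound for the derivative on \<open>{-R..R}\<close>; the summand 1 takes
    care of arguments below 1.\<close>
  let ?L = "p * (1 + \<bar>R\<bar> powr p)"
  have "\<bar>signed_powr p s - signed_powr p t\<bar> \<le> ?L * \<bar>s - t\<bar>" if "s \<in> {-R..R}" "t \<in> {-R..R}" for s t
  proof -
    have "norm (signed_powr p s - signed_powr p t) \<le> ?L * norm (s - t)"
    proof (rule field_differentiable_bound[OF convex_closed_interval[of "-R" R]])
      fix z assume z: "z \<in> {-R..R}"
      show "(signed_powr p has_field_derivative p * nonneg_power \<bar>z\<bar> (p - 1)) (at z within {-R..R})"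
        by (rule has_field_derivative_at_within[OF DERIV_signed_powr[OF assms(1)]])
      have "nonneg_power \<bar>z\<bar> (p - 1) \<le> 1 + \<bar>z\<bar> powr p" by (rule nonneg_power_le[OF assms(1)])
      also have "\<dots> \<le> 1 + \<bar>R\<bar> powr p" using z assms(1) by (intro add_left_mono powr_mono2) auto
      finally show "norm (p * nonneg_power \<bar>z\<bar> (p - 1)) \<le> ?L"
        using assms(1) nonneg_power_nonneg[of z] by (simp add: abs_mult)
    qed (use that in auto)
    then show ?thesis by simp
  qed
  moreover have "?L > 0" using assms(1) powr_ge_zero[of "\<bar>R\<bar>" p] by (intro mult_pos_pos) linarith+
  ultimately show "\<exists>L>0. \<forall>s\<in>{-R..R}. \<forall>t\<in>{-R..R}. \<bar>signed_powr p s - signed_powr p t\<bar> \<le> L * \<bar>s - t\<bar>"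
    by blast
qed

lemma Lp_norm_le_mult:
  assumes "p \<ge> 1" "C > 0"
    and le: "(\<integral>\<^sup>+x. ennreal (\<bar>g x\<bar> powr p) \<partial>M) \<le> ennreal (C powr p) * (\<integral>\<^sup>+x. ennreal (\<bar>h x\<bar> powr p) \<partial>M)"
  shows "Lp_norm M p g \<le> ennreal C * Lp_norm M p h"
proof (cases "(\<integral>\<^sup>+x. ennreal (\<bar>h x\<bar> powr p) \<partial>M) = \<infinity>")
  \<comment> \<open>A positive \<open>C\<close> matters here, since \<open>0 * \<infinity>\<close>
    is 0.\<close>
  case True
  then show ?thesis using assms(2) by (simp add: Lp_norm_def ennreal_mult_top)
next
  case False
  then obtain b where b: "b \<ge> 0" "(\<integral>\<^sup>+x. ennreal (\<bar>h x\<bar> powr p) \<partial>M) = ennreal b"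
    by (cases "\<integral>\<^sup>+x. ennreal (\<bar>h x\<bar> powr p) \<partial>M") auto
  with le have le': "(\<integral>\<^sup>+x. ennreal (\<bar>g x\<bar> powr p) \<partial>M) \<le> ennreal (C powr p * b)"
    by (simp add: ennreal_mult)
  then have "(\<integral>\<^sup>+x. ennreal (\<bar>g x\<bar> powr p) \<partial>M) \<noteq> \<infinity>" by (auto simp: top_unique)
  then obtain a where a: "a \<ge> 0" "(\<integral>\<^sup>+x. ennreal (\<bar>g x\<bar> powr p) \<partial>M) = ennreal a"
    by (cases "\<integral>\<^sup>+x. ennreal (\<bar>g x\<bar> powr p) \<partial>M") auto
  have "a \<le> C powr p * b" using le' a b by (simp add: ennreal_le_iff)
  then have "a powr (1 / p) \<le> (C powr p * b) powr (1 / p)" using a assms by (intro powr_mono2) auto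
  also have "\<dots> = C * b powr (1 / p)" using assms b by (simp add: powr_mult powr_powr)
  finally show ?thesis using assms a b
    by (simp add: Lp_norm_def flip: ennreal_mult)
qed

text \<open>An equality of functions, valid also where no derivative exists: both sides choose from
  the same predicate.\<close>

lemma deriv_diff_const: "deriv (\<lambda>x. u x - a) = deriv (u :: real \<Rightarrow> real)"
  unfolding deriv_def DERIV_def by simp

section \<open>Moment inequalities on a probability space\<close>

context prob_space
begin

lemma integrable_powr_diff_const:
  fixes z :: "'a \<Rightarrow> real"
  assumes "p \<ge> 1" "z \<in> borel_measurable M" "integrable M (\<lambda>x. \<bar>z x\<bar> powr p)"
  shows "integrable M (\<lambda>x. \<bar>z x - a\<bar> powr p)"
proof (rule Bochner_Integration.integrable_bound)
  show "integrable M (\<lambda>x. 2 powr p / 2 * (\<bar>z x\<bar> powr p + \<bar>- a\<bar> powr p))"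
    using assms(3) by auto
  show "(\<lambda>x. \<bar>z x - a\<bar> powr p) \<in> borel_measurable M" using assms(2) by measurable
  show "AE x in M. norm (\<bar>z x - a\<bar> powr p) \<le> norm (2 powr p / 2 * (\<bar>z x\<bar> powr p + \<bar>- a\<bar> powr p))"
    using powr_sum_le[OF assms(1), of "z x" "- a" for x] by (intro AE_I2) simp
qed

lemma integrable_of_powr:
  fixes z :: "'a \<Rightarrow> real"
  assumes "p \<ge> 1" "z \<in> borel_measurable M" "integrable M (\<lambda>x. \<bar>z x\<bar> powr p)"
  shows "integrable M z" "integrable M (\<lambda>x. rsign (z x) * nonneg_power \<bar>z x\<bar> (p - 1))"
proof -
  have bd: "integrable M (\<lambda>x. 1 + \<bar>z x\<bar> powr p)" using assms(3) by auto
  have "\<bar>t\<bar> \<le> 1 + \<bar>t\<bar> powr p" for t :: real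
  proof (cases "\<bar>t\<bar> \<ge> 1")
    case True
    then show ?thesis using powr_mono[of 1 p "\<bar>t\<bar>"] assms(1) by simp
  next
    case False
    then show ?thesis using powr_ge_zero[of "\<bar>t\<bar>" p] by linarith
  qed
  then show "integrable M z"
    by (intro Bochner_Integration.integrable_bound[OF bd assms(2)] AE_I2) (simp add: add_nonneg_nonneg)
  have meas: "(\<lambda>x. rsign (z x) * nonneg_power \<bar>z x\<bar> (p - 1)) \<in> borel_measurable M"
    unfolding rsign_cases nonneg_power_def using assms(2) by measurable
  show "integrable M (\<lambda>x. rsign (z x) * nonneg_power \<bar>z x\<bar> (p - 1))"
  proof (intro Bochner_Integration.integrable_bound[OF bd meas] AE_I2)
    fix x
    have "norm (rsign (z x) * nonneg_power \<bar>z x\<bar> (p - 1)) = nonneg_power \<bar>z x\<bar> (p - 1)"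
      unfolding real_norm_def abs_mult abs_of_nonneg[OF nonneg_power_nonneg] by (simp add: rsign_cases)
    also have "\<dots> \<le> norm (1 + \<bar>z x\<bar> powr p)"
      using nonneg_power_le[OF assms(1), of "z x"] by simp
    finally show "norm (rsign (z x) * nonneg_power \<bar>z x\<bar> (p - 1)) \<le> norm (1 + \<bar>z x\<bar> powr p)" .
  qed
qed

text \<open>Jensen's inequality: the supporting line at the mean is integrated, and its linear term
  has expectation 0.\<close>

lemma powr_expectation_le:
  fixes z :: "'a \<Rightarrow> real"
  assumes "p \<ge> 1" "z \<in> borel_measurable M" "integrable M (\<lambda>x. \<bar>z x\<bar> powr p)"
  shows "\<bar>expectation z\<bar> powr p \<le> expectation (\<lambda>x. \<bar>z x\<bar> powr p)"
proof -
  let ?e = "expectation z" and ?g = "p * (rsign (expectation z) * nonneg_power \<bar>expectation z\<bar> (p - 1))"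
  note z = integrable_of_powr(1)[OF assms]
  have "(\<integral>x. \<bar>?e\<bar> powr p + ?g * (z x - ?e) \<partial>M) \<le> expectation (\<lambda>x. \<bar>z x\<bar> powr p)"
    using z assms(3) by (intro integral_mono powr_subgradient[OF assms(1)]) auto
  moreover have "(\<integral>x. \<bar>?e\<bar> powr p + ?g * (z x - ?e) \<partial>M) = \<bar>?e\<bar> powr p"
    using z by (simp add: prob_space)
  ultimately show ?thesis by simp
qed

text \<open>The midpoint bound separates \<open>z\<close> from its mean at the price of
  \<open>2 powr p / 2\<close>, and Jensen bounds the moment of the mean by that of \<open>z\<close>,
  which doubles the factor.\<close>

lemma central_powr_le:
  fixes z :: "'a \<Rightarrow> real"
  assumes "p \<ge> 1" "z \<in> borel_measurable M" "integrable M (\<lambda>x. \<bar>z x\<bar> powr p)"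
  shows "expectation (\<lambda>x. \<bar>z x - expectation z\<bar> powr p) \<le> 2 powr p * expectation (\<lambda>x. \<bar>z x\<bar> powr p)"
proof -
  let ?e = "expectation z"
  have "expectation (\<lambda>x. \<bar>z x - ?e\<bar> powr p) \<le> expectation (\<lambda>x. 2 powr p / 2 * (\<bar>z x\<bar> powr p + \<bar>- ?e\<bar> powr p))"
    using powr_sum_le[OF assms(1), of "z x" "- ?e" for x] assms(3)
    by (intro integral_mono integrable_powr_diff_const[OF assms]) auto
  also have "\<dots> = 2 powr p / 2 * (expectation (\<lambda>x. \<bar>z x\<bar> powr p) + \<bar>?e\<bar> powr p)"
    using assms(3) by (simp add: prob_space)
  also have "\<dots> \<le> 2 powr p / 2 * (expectation (\<lambda>x. \<bar>z x\<bar> powr p) + expectation (\<lambda>x. \<bar>z x\<bar> powr p))"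
    by (intro mult_left_mono add_left_mono powr_expectation_le[OF assms]) simp
  finally show ?thesis by simp
qed

text \<open>The assumption is the first-order condition for a minimum at 0 of the convex function
  \<open>a \<mapsto> E \<bar>z - a\<bar> powr p\<close>: the slopes of the supporting lines at
  \<open>z x\<close> average to 0.\<close>

lemma powr_minimal_at_zero:
  fixes z :: "'a \<Rightarrow> real"
  assumes "p \<ge> 1" "z \<in> borel_measurable M" "integrable M (\<lambda>x. \<bar>z x\<bar> powr p)"
    and "expectation (\<lambda>x. rsign (z x) * nonneg_power \<bar>z x\<bar> (p - 1)) = 0"
  shows "expectation (\<lambda>x. \<bar>z x\<bar> powr p) \<le> expectation (\<lambda>x. \<bar>z x - a\<bar> powr p)"
proof -
  let ?g = "\<lambda>x. rsign (z x) * nonneg_power \<bar>z x\<bar> (p - 1)"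
  have "(\<integral>x. \<bar>z x\<bar> powr p + - (p * a) * ?g x \<partial>M) \<le> expectation (\<lambda>x. \<bar>z x - a\<bar> powr p)"
  proof (intro integral_mono integrable_powr_diff_const[OF assms(1-3)])
    show "integrable M (\<lambda>x. \<bar>z x\<bar> powr p + - (p * a) * ?g x)"
      using assms(3) integrable_of_powr(2)[OF assms(1-3)]
      by (intro Bochner_Integration.integrable_add integrable_mult_right)
    show "\<bar>z x\<bar> powr p + - (p * a) * ?g x \<le> \<bar>z x - a\<bar> powr p" for x
      using powr_subgradient[OF assms(1), of "z x" "z x - a"] by (simp add: algebra_simps)
  qed
  moreover have "(\<integral>x. \<bar>z x\<bar> powr p + - (p * a) * ?g x \<partial>M) = expectation (\<lambda>x. \<bar>z x\<bar> powr p) + - (p * a) * expectation ?g"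
    using assms(3) integrable_of_powr(2)[OF assms(1-3)]
    by (subst Bochner_Integration.integral_add) (auto simp: mult.assoc)
  ultimately show ?thesis using assms(4) by simp
qed

text \<open>Young's inequality takes the place of Hoelder's: a fraction \<open>1 - 1/p\<close> of the \<open>p\<close>-th moment of \<open>z\<close>
  is absorbed into the left-hand side, which is possible because that moment is finite.\<close>

lemma absorb_by_Young:
  fixes z d :: "'a \<Rightarrow> real"
  assumes p: "p \<ge> 1" and k: "k \<ge> 0" and [measurable]: "z \<in> borel_measurable M" "d \<in> borel_measurable M"
    and fin: "(\<integral>\<^sup>+x. ennreal (\<bar>z x\<bar> powr p) \<partial>M) < \<infinity>"
    and le: "(\<integral>\<^sup>+x. ennreal (\<bar>z x\<bar> powr p) \<partial>M)
      \<le> ennreal k * (\<integral>\<^sup>+x. ennreal \<bar>p * nonneg_power \<bar>z x\<bar> (p - 1) * d x\<bar> \<partial>M)"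
  shows "(\<integral>\<^sup>+x. ennreal (\<bar>z x\<bar> powr p) \<partial>M)
    \<le> ennreal ((k * p) powr p) * (\<integral>\<^sup>+x. ennreal (\<bar>d x\<bar> powr p) \<partial>M)"
proof -
  let ?A = "\<integral>\<^sup>+x. ennreal (\<bar>z x\<bar> powr p) \<partial>M"
  let ?B = "\<integral>\<^sup>+x. ennreal (\<bar>d x\<bar> powr p) \<partial>M"
  let ?C = "(k * p) powr p"
  have [measurable]: "(\<lambda>x. nonneg_power \<bar>z x\<bar> (p - 1)) \<in> borel_measurable M"
    unfolding nonneg_power_def by measurable
  obtain a where a: "a \<ge> 0" "?A = ennreal a" using fin by (cases ?A) auto
  have "ennreal p * ?A \<le> ennreal p * (ennreal k * (\<integral>\<^sup>+x. ennreal \<bar>p * nonneg_power \<bar>z x\<bar> (p - 1) * d x\<bar> \<partial>M))"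
    by (intro mult_left_mono le) simp
  also have "\<dots> = (\<integral>\<^sup>+x. ennreal (p * k) * ennreal \<bar>p * nonneg_power \<bar>z x\<bar> (p - 1) * d x\<bar> \<partial>M)"
    using p k by (subst nn_integral_cmult) (auto simp: ennreal_mult mult.assoc)
  also have "\<dots> \<le> (\<integral>\<^sup>+x. ennreal (p - 1) * ennreal (\<bar>z x\<bar> powr p) + ennreal ?C * ennreal (\<bar>d x\<bar> powr p) \<partial>M)"
  proof (rule nn_integral_mono)
    fix x
    \<comment> \<open>The constant \<open>k * p\<close> is moved onto \<open>d\<close> before
      Young's inequality is applied, so that it reappears as its \<open>p\<close>-th power and
      leaves the coefficient \<open>p - 1\<close> of the moment of \<open>z\<close>
      unchanged.\<close>
    have "p * k * \<bar>p * nonneg_power \<bar>z x\<bar> (p - 1) * d x\<bar> = p * nonneg_power \<bar>z x\<bar> (p - 1) * \<bar>k * p * d x\<bar>"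
      using p k nonneg_power_nonneg[of "z x" "p - 1"] by (simp add: abs_mult mult_ac)
    also have "\<dots> \<le> (p - 1) * \<bar>z x\<bar> powr p + \<bar>k * p * d x\<bar> powr p" by (rule Young_power[OF p])
    also have "\<bar>k * p * d x\<bar> powr p = ?C * \<bar>d x\<bar> powr p" using p k by (simp add: abs_mult powr_mult)
    finally have "ennreal (p * k * \<bar>p * nonneg_power \<bar>z x\<bar> (p - 1) * d x\<bar>)
      \<le> ennreal ((p - 1) * \<bar>z x\<bar> powr p + ?C * \<bar>d x\<bar> powr p)" by (rule ennreal_leI)
    then show "ennreal (p * k) * ennreal \<bar>p * nonneg_power \<bar>z x\<bar> (p - 1) * d x\<bar>
      \<le> ennreal (p - 1) * ennreal (\<bar>z x\<bar> powr p) + ennreal ?C * ennreal (\<bar>d x\<bar> powr p)"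
      using p k by (simp add: ennreal_plus ennreal_mult)
  qed
  also have "\<dots> = ennreal (p - 1) * ?A + ennreal ?C * ?B"
    by (subst nn_integral_add) (auto simp: nn_integral_cmult)
  finally have *: "ennreal p * ?A \<le> ennreal (p - 1) * ?A + ennreal ?C * ?B" .
  \<comment> \<open>Against the factor \<open>p\<close> on the left, the finite moment can be
    subtracted \<open>p - 1\<close> times; an infinite right-hand side is trivial.\<close>
  show ?thesis
  proof (cases "ennreal ?C * ?B")
    case (real b)
    then have "ennreal (p * a) \<le> ennreal ((p - 1) * a + b)"
      using * a p by (simp add: ennreal_mult ennreal_plus)
    then have "p * a \<le> (p - 1) * a + b" using a real p by (subst (asm) ennreal_le_iff) auto
    then have "a \<le> b" by (simp add: algebra_simps)
    then show ?thesis unfolding real a(2) by (rule ennreal_leI)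
  qed simp
qed

end

section \<open>From first moments to moments of order p\<close>

context density_distribution
begin

text \<open>The chain rule turns the derivative of the signed power into
  \<open>p * \<bar>z\<bar> ^ (p - 1) * z'\<close>, the form that can be absorbed. The free constant
  \<open>k\<close> allows both \<open>1 / c\<close> and \<open>2 / c\<close>; a Borel version of the
  derivative stands in for \<open>deriv z\<close> meanwhile.\<close>

lemma Lp_Poincare_of_L1:
  assumes p: "p \<ge> 1" and k: "k \<ge> 0" and z: "locally_abs_continuous z"
    and fin: "(\<integral>\<^sup>+x. ennreal (\<bar>z x\<bar> powr p) \<partial>M) < \<infinity>"
    and le: "(\<integral>\<^sup>+x. ennreal \<bar>signed_powr p (z x)\<bar> \<partial>M) \<le> ennreal k * (\<integral>\<^sup>+x. ennreal \<bar>deriv (\<lambda>x. signed_powr p (z x)) x\<bar> \<partial>M)"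
  shows "(\<integral>\<^sup>+x. ennreal (\<bar>z x\<bar> powr p) \<partial>M) \<le> ennreal ((k * p) powr p) * (\<integral>\<^sup>+x. ennreal (\<bar>deriv z x\<bar> powr p) \<partial>M)"
proof -
  obtain g where g[measurable]: "g \<in> borel_measurable borel" and zg: "AE x in lborel. DERIV z x :> g x"
    using locally_abs_continuous_deriv_AE[OF z] by blast
  have AEg: "AE x in M. DERIV z x :> g x" by (rule AE_lborel_imp_AE[OF zg])
  have zm: "z \<in> borel_measurable M"
    using locally_abs_continuous_imp_isCont[OF z]
    by (intro measurable_finite_borel borel_measurable_continuous_onI continuous_at_imp_continuous_on) auto
  have "(\<integral>\<^sup>+x. ennreal \<bar>deriv (\<lambda>x. signed_powr p (z x)) x\<bar> \<partial>M)
    = (\<integral>\<^sup>+x. ennreal \<bar>p * nonneg_power \<bar>z x\<bar> (p - 1) * g x\<bar> \<partial>M)"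
    using AEg
  proof (intro nn_integral_cong_AE, eventually_elim)
    fix x assume "DERIV z x :> g x"
    then have "DERIV (\<lambda>x. signed_powr p (z x)) x :> p * nonneg_power \<bar>z x\<bar> (p - 1) * g x"
      by (rule DERIV_chain2[OF DERIV_signed_powr[OF p]])
    then show "ennreal \<bar>deriv (\<lambda>x. signed_powr p (z x)) x\<bar> = ennreal \<bar>p * nonneg_power \<bar>z x\<bar> (p - 1) * g x\<bar>"
      by (simp add: DERIV_imp_deriv)
  qed
  with le have "(\<integral>\<^sup>+x. ennreal (\<bar>z x\<bar> powr p) \<partial>M)
      \<le> ennreal k * (\<integral>\<^sup>+x. ennreal \<bar>p * nonneg_power \<bar>z x\<bar> (p - 1) * g x\<bar> \<partial>M)"
    by (simp add: abs_signed_powr)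
  then have "(\<integral>\<^sup>+x. ennreal (\<bar>z x\<bar> powr p) \<partial>M) \<le> ennreal ((k * p) powr p) * (\<integral>\<^sup>+x. ennreal (\<bar>g x\<bar> powr p) \<partial>M)"
    by (intro absorb_by_Young p k zm fin) simp_all
  also have "(\<integral>\<^sup>+x. ennreal (\<bar>g x\<bar> powr p) \<partial>M) = (\<integral>\<^sup>+x. ennreal (\<bar>deriv z x\<bar> powr p) \<partial>M)"
    using AEg by (intro nn_integral_cong_AE, eventually_elim) (simp add: DERIV_imp_deriv)
  finally show ?thesis .
qed

lemma Lp_Poincare_median:
  assumes c: "c > 0" "\<forall>x D. DERIV (cdf M) x :> D \<longrightarrow> c * min (cdf M x) (1 - cdf M x) \<le> D"
    and p: "p \<ge> 1" and u: "locally_abs_continuous u" and x0: "cdf M x0 = 1 / 2"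
    and fin: "(\<integral>\<^sup>+x. ennreal (\<bar>u x - u x0\<bar> powr p) \<partial>M) < \<infinity>"
  shows "(\<integral>\<^sup>+x. ennreal (\<bar>u x - u x0\<bar> powr p) \<partial>M)
    \<le> ennreal ((p / c) powr p) * (\<integral>\<^sup>+x. ennreal (\<bar>deriv u x\<bar> powr p) \<partial>M)"
proof -
  let ?z = "\<lambda>x. u x - u x0"
  have z: "locally_abs_continuous ?z"
    by (rule locally_abs_continuous_compose[OF u]) (auto intro!: exI[of _ 1])
  \<comment> \<open>Since \<open>?z\<close> vanishes at \<open>x0\<close>, so does its signed power,
    and the centring term of the first-moment bound disappears.\<close>
  have "(\<integral>\<^sup>+x. ennreal \<bar>signed_powr p (?z x)\<bar> \<partial>M)
    \<le> ennreal (1 / c) * (\<integral>\<^sup>+x. ennreal \<bar>deriv (\<lambda>x. signed_powr p (?z x)) x\<bar> \<partial>M)"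
    using L1_median_Cheeger[OF c locally_abs_continuous_signed_powr[OF p z] x0]
    by (simp add: signed_powr_def[of p 0])
  from Lp_Poincare_of_L1[OF p _ z fin this] c(1) show ?thesis
    by (simp add: deriv_diff_const)
qed

end

theorem theorem3p3:
  fixes M :: "real measure" and f :: "real \<Rightarrow> real" and p :: real and u v :: "real \<Rightarrow> real"
  assumes "prob_space M"
    and "f \<in> borel_measurable borel"
    and "\<forall>x. f x > 0"
    and "M = density lborel (\<lambda>x. ennreal (f x))"
    and "cheeger_const M > 0"
    and "p \<ge> 1"
    and "u \<in> Lp_functions M p"
    and "locally_abs_continuous u"
    and v_eq: "v = (\<lambda>x. u x - (\<integral>y. u y \<partial>M))"
  shows
    "Lp_norm M p v \<le> ennreal (2 * p) * inverse (cheeger_const M) * Lp_norm M p (deriv u)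
     \<and> ((\<integral>x. rsign (v x) * nonneg_power \<bar>v x\<bar> (p - 1) \<partial>M) = 0 \<longrightarrow>
          Lp_norm M p v \<le> ennreal p * inverse (cheeger_const M) * Lp_norm M p (deriv u))
     \<and> (\<forall>n::nat. p = real n \<and> even n \<and> (\<integral>x. v x ^ (n - 1) \<partial>M) = 0 \<longrightarrow>
          (\<integral>x. rsign (v x) * nonneg_power \<bar>v x\<bar> (p - 1) \<partial>M) = 0)
     \<and> (\<forall>n::nat. p = real n \<and> odd n \<and> (\<integral>x. u x ^ n \<partial>M) = 0 \<longrightarrow>
          Lp_norm M p u \<le> ennreal (2 * p) * inverse (cheeger_const M) * Lp_norm M p (deriv u))
     \<and> (\<forall>n::nat. p = real n \<and> odd n \<and> (\<integral>x. u x ^ n \<partial>M) = 0 \<and>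
          (\<integral>x. rsign (u x ^ n) \<partial>M) = 0 \<longrightarrow>
          Lp_norm M p u \<le> ennreal p * inverse (cheeger_const M) * Lp_norm M p (deriv u))"
proof -
  interpret density_distribution M "\<lambda>x. ennreal (f x)"
  proof (intro density_distribution.intro real_distribution.intro assms(1))
    show "real_distribution_axioms M" by (standard) (simp add: assms(4))
    show "density_distribution_axioms M (\<lambda>x. ennreal (f x))"
      by standard (use assms(2,4) in auto)
  qed
  note p = \<open>p \<ge> 1\<close> and u = \<open>locally_abs_continuous u\<close>
  have um: "u \<in> borel_measurable M" using assms(7) by (simp add: Lp_functions_def)
  have "(\<integral>\<^sup>+x. ennreal (\<bar>u x\<bar> powr p) \<partial>M) < \<infinity>"
    using assms(7) by (auto simp: Lp_functions_def Lp_norm_def Let_def less_top split: if_splits)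
  then have ui: "integrable M (\<lambda>x. \<bar>u x\<bar> powr p)"
    using um by (intro integrableI_bounded) auto
  note di = integrable_powr_diff_const[OF p um ui]
  have nn: "(\<integral>\<^sup>+x. ennreal (\<bar>u x - a\<bar> powr p) \<partial>M) = ennreal (\<integral>x. \<bar>u x - a\<bar> powr p \<partial>M)" for a
    by (rule nn_integral_eq_integral[OF di]) simp
  obtain c where c: "c > 0" "cheeger_const M = ennreal c"
    "\<forall>x D. DERIV (cdf M) x :> D \<longrightarrow> c * min (cdf M x) (1 - cdf M x) \<le> D"
    by (rule cheeger_const_le_deriv_cdf[OF assms(5)])
  obtain x0 where x0: "cdf M x0 = 1 / 2" using ex_median by blast
  have const: "ennreal q * inverse (cheeger_const M) = ennreal (q / c)" if "q \<ge> 0" for q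
    using c that by (simp add: inverse_ennreal divide_inverse ennreal_mult)
  let ?D = "\<integral>\<^sup>+x. ennreal (\<bar>deriv u x\<bar> powr p) \<partial>M"
  have base: "ennreal (\<integral>x. \<bar>u x - u x0\<bar> powr p \<partial>M) \<le> ennreal ((p / c) powr p) * ?D"
    using Lp_Poincare_median[OF c(1,3) p u x0] by (simp add: nn)
  have p0: "p > 0" using p by simp
  have prob_UNIV: "prob UNIV = 1" using prob_space by simp
  have vm: "v \<in> borel_measurable M" using um unfolding v_eq by simp
  have vi: "integrable M (\<lambda>x. \<bar>v x\<bar> powr p)" unfolding v_eq by (rule di)

  have part1: "Lp_norm M p v \<le> ennreal (2 * p / c) * Lp_norm M p (deriv u)"
  proof (rule Lp_norm_le_mult[OF p])
    \<comment> \<open>Centring \<open>u - u x0\<close> at its mean gives \<open>v\<close>, so the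
      bound for central moments applies to it.\<close>
    have "expectation (\<lambda>x. u x - u x0) = expectation u - u x0"
      using integrable_of_powr(1)[OF p um ui] by (simp add: prob_UNIV)
    then have "(\<integral>x. \<bar>v x\<bar> powr p \<partial>M) \<le> 2 powr p * (\<integral>x. \<bar>u x - u x0\<bar> powr p \<partial>M)"
      using central_powr_le[OF p _ di, of "u x0"] um by (simp add: v_eq)
    then have "ennreal (\<integral>x. \<bar>v x\<bar> powr p \<partial>M) \<le> ennreal (2 powr p) * ennreal (\<integral>x. \<bar>u x - u x0\<bar> powr p \<partial>M)"
      by (simp add: ennreal_leI flip: ennreal_mult)
    also have "\<dots> \<le> ennreal (2 powr p) * (ennreal ((p / c) powr p) * ?D)"
      by (intro mult_left_mono base) simp
    also have "\<dots> = ennreal ((2 * p / c) powr p) * ?D"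
      using c(1) p0 by (simp add: powr_mult powr_divide mult.assoc[symmetric] flip: ennreal_mult)
    finally show "(\<integral>\<^sup>+x. ennreal (\<bar>v x\<bar> powr p) \<partial>M) \<le> ennreal ((2 * p / c) powr p) * ?D"
      unfolding v_eq nn .
  qed (use c(1) p0 in simp)

  have part2: "Lp_norm M p v \<le> ennreal (p / c) * Lp_norm M p (deriv u)"
    if "(\<integral>x. rsign (v x) * nonneg_power \<bar>v x\<bar> (p - 1) \<partial>M) = 0"
  proof (rule Lp_norm_le_mult[OF p])
    \<comment> \<open>The shift is chosen so that the competitor is \<open>u - u x0\<close>:
      minimality at 0 lets the mean do at least as well as the value at the median.\<close>
    have "(\<integral>x. \<bar>v x\<bar> powr p \<partial>M) \<le> (\<integral>x. \<bar>v x - (u x0 - expectation u)\<bar> powr p \<partial>M)"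
      by (rule powr_minimal_at_zero[OF p vm vi that])
    then have "ennreal (\<integral>x. \<bar>v x\<bar> powr p \<partial>M) \<le> ennreal (\<integral>x. \<bar>u x - u x0\<bar> powr p \<partial>M)"
      by (simp add: v_eq ennreal_leI)
    also note base
    finally show "(\<integral>\<^sup>+x. ennreal (\<bar>v x\<bar> powr p) \<partial>M) \<le> ennreal ((p / c) powr p) * ?D"
      unfolding v_eq nn .
  qed (use c(1) p0 in simp)

  have part2b: "(\<integral>x. rsign (v x) * nonneg_power \<bar>v x\<bar> (p - 1) \<partial>M) = 0"
    if n: "p = real n" "even n" "(\<integral>x. v x ^ (n - 1) \<partial>M) = 0" for n :: nat
  proof -
    \<comment> \<open>Evenness together with \<open>p \<ge> 1\<close> excludes \<open>n = 0\<close>;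
      hence \<open>p - 1\<close> is a positive odd integer, and the sign times the power is an
      ordinary power.\<close>
    have "n \<ge> 2" using n p by (cases n) (auto elim!: oddE simp: Suc_le_eq)
    then have odd: "odd (n - 1)" and p1: "p - 1 = real (n - 1)" "p \<noteq> 1" using n by auto
    have "rsign t * nonneg_power \<bar>t\<bar> (p - 1) = t ^ (n - 1)" for t
      using signed_powr_odd[OF odd, of t] p1 by (simp add: nonneg_power_def signed_powr_def)
    then show ?thesis using n(3) by simp
  qed

  \<comment> \<open>Here the power is taken before subtracting the value at the median, since the
    hypotheses concern \<open>u ^ n\<close>. The factor \<open>c * k\<close> is the loss in passing
    from centring at \<open>u x0 ^ n\<close> to no centring; the Cheeger factor \<open>1 / c\<close>
    reduces it to \<open>k\<close>.\<close>
  have odd_case: "Lp_norm M p u \<le> ennreal (k * p) * Lp_norm M p (deriv u)"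
    if n: "p = real n" "odd n" and k: "k > 0"
      and le: "ennreal (\<integral>x. \<bar>u x ^ n\<bar> \<partial>M) \<le> ennreal (c * k) * ennreal (\<integral>x. \<bar>u x ^ n - u x0 ^ n\<bar> \<partial>M)" for n k
  proof (rule Lp_norm_le_mult[OF p])
    let ?w = "\<lambda>x. signed_powr p (u x)"
    have w: "?w x = u x ^ n" for x using n signed_powr_odd by simp
    have wm: "(\<lambda>x. u x ^ n) \<in> borel_measurable M" using um by simp
    have abs_w: "\<bar>u x ^ n\<bar> = \<bar>u x\<bar> powr p" for x
      using abs_signed_powr[of p "u x"] by (simp add: w)
    have wi: "integrable M (\<lambda>x. u x ^ n)"
      using ui by (subst integrable_abs_iff[symmetric, OF wm]) (simp add: abs_w)
    have "ennreal (\<integral>x. \<bar>u x ^ n\<bar> \<partial>M) \<le> ennreal (c * k) * ennreal (\<integral>x. \<bar>u x ^ n - u x0 ^ n\<bar> \<partial>M)"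
      by (rule le)
    also have "ennreal (\<integral>x. \<bar>u x ^ n - u x0 ^ n\<bar> \<partial>M) = (\<integral>\<^sup>+x. ennreal \<bar>?w x - ?w x0\<bar> \<partial>M)"
      unfolding w using wi by (intro nn_integral_eq_integral[symmetric]) auto
    also have "ennreal (c * k) * \<dots> \<le> ennreal (c * k) * (ennreal (1 / c) * (\<integral>\<^sup>+x. ennreal \<bar>deriv ?w x\<bar> \<partial>M))"
      by (intro mult_left_mono L1_median_Cheeger[OF c(1,3) _ x0]
          locally_abs_continuous_signed_powr p u) simp
    also have "\<dots> = ennreal k * (\<integral>\<^sup>+x. ennreal \<bar>deriv ?w x\<bar> \<partial>M)"
      using c(1) k by (simp add: mult.assoc[symmetric] flip: ennreal_mult)
    also have "ennreal (\<integral>x. \<bar>u x ^ n\<bar> \<partial>M) = (\<integral>\<^sup>+x. ennreal \<bar>?w x\<bar> \<partial>M)"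
      unfolding w using wi by (intro nn_integral_eq_integral[symmetric]) auto
    finally show "(\<integral>\<^sup>+x. ennreal (\<bar>u x\<bar> powr p) \<partial>M) \<le> ennreal ((k * p) powr p) * ?D"
      using k nn[of 0] by (intro Lp_Poincare_of_L1[OF p _ u]) auto
  qed (use k p0 in simp)

  \<comment> \<open>The exponent 1 is kept visible so that the general moment lemmas can be used
    with \<open>p = 1\<close> for \<open>u ^ n\<close>.\<close>
  have odd_integrable: "(\<lambda>x. u x ^ n) \<in> borel_measurable M" "integrable M (\<lambda>x. \<bar>u x ^ n\<bar> powr 1)"
    if n: "p = real n" "odd n" for n
  proof -
    show "(\<lambda>x. u x ^ n) \<in> borel_measurable M" using um by simp
    have "\<bar>u x ^ n\<bar> = \<bar>u x\<bar> powr p" for x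
      using abs_signed_powr[of p "u x"] signed_powr_odd[OF n(2), of "u x"] by (simp add: n(1))
    then show "integrable M (\<lambda>x. \<bar>u x ^ n\<bar> powr 1)" using ui by simp
  qed

  have part3: "Lp_norm M p u \<le> ennreal (2 * p / c) * Lp_norm M p (deriv u)"
    if n: "p = real n" "odd n" and mean: "(\<integral>x. u x ^ n \<partial>M) = 0" for n
  proof -
    let ?z = "\<lambda>x. u x ^ n - u x0 ^ n"
    note w = odd_integrable[OF n]
    note wi = integrable_of_powr(1)[OF order_refl w]
    \<comment> \<open>Because \<open>u ^ n\<close> has mean 0, centring \<open>?z\<close> gives back
      \<open>u ^ n\<close>; at exponent 1 the cost of centring is the factor 2.\<close>
    have "expectation ?z = - (u x0 ^ n)" using mean wi by (simp add: prob_UNIV)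
    then have "(\<integral>x. \<bar>u x ^ n\<bar> \<partial>M) \<le> 2 * (\<integral>x. \<bar>?z x\<bar> \<partial>M)"
      using central_powr_le[of 1 ?z] wi w(1) by simp
    then have "ennreal (\<integral>x. \<bar>u x ^ n\<bar> \<partial>M) \<le> ennreal (c * (2 / c)) * ennreal (\<integral>x. \<bar>?z x\<bar> \<partial>M)"
      using c(1) by (subst ennreal_mult[symmetric]) (auto intro!: ennreal_leI)
    from odd_case[OF n _ this] c(1) show ?thesis by simp
  qed

  have part4: "Lp_norm M p u \<le> ennreal (p / c) * Lp_norm M p (deriv u)"
    if n: "p = real n" "odd n" and median: "(\<integral>x. rsign (u x ^ n) \<partial>M) = 0" for n
  proof -
    note w = odd_integrable[OF n]
    \<comment> \<open>At exponent 1 the first-order condition involves only the sign, so 0 minimises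
      the mean absolute deviation of \<open>u ^ n\<close> and no factor is lost.\<close>
    have "(\<integral>x. \<bar>u x ^ n\<bar> \<partial>M) \<le> (\<integral>x. \<bar>u x ^ n - u x0 ^ n\<bar> \<partial>M)"
      using powr_minimal_at_zero[OF order_refl w] median by (simp add: nonneg_power_def)
    then have "ennreal (\<integral>x. \<bar>u x ^ n\<bar> \<partial>M) \<le> ennreal (c * (1 / c)) * ennreal (\<integral>x. \<bar>u x ^ n - u x0 ^ n\<bar> \<partial>M)"
      using c(1) by (simp add: ennreal_leI)
    from odd_case[OF n _ this] c(1) show ?thesis by simp
  qed

  show ?thesis
    using part1 part2 part2b part3 part4 p0 by (simp add: const)
qed

end
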